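(* Let $p$ be a prime. Fix $\varepsilon\in(0,1)$ and $0\le\alpha,\beta\le2$, and let $c$ be defined by $c^{-1}=\max(\alpha+\beta-1,2)$. Then there exists a constant $C(p,\varepsilon)>0$, which may be chosen to be any real number satisfying $$C(p,\varepsilon)>\max\{p^{1-\varepsilon},(p^{\varepsilon}-1)^{-1}\},$$ such that for every integer $k\ge1$, all constants $K_\alpha,K_\beta>0$, every $(p^{-k},\alpha,K_\alpha)$-set of weighted points $\mathcal{P}$ in $R_k^2$ and every $(p^{-k},\beta,K_\beta)$-set of weighted lines $\mathcal{L}$ in $R_k^2$, $$I_w(\mathcal{P},\mathcal{L})\le C(p,\varepsilon)\,p^{k(c+\varepsilon)}(K_\alpha K_\beta)^c\,|\mathcal{P}|_w^{1-c}|\mathcal{L}|_w^{1-c}.$$ In particular, if $\mathcal{P}$ and $\mathcal{L}$ are such sets of unweighted points and lines (all weights equal to $1$), then $$I(\mathcal{P},\mathcal{L})\le C(p,\varepsilon)\,p^{k(c+\varepsilon)}(K_\alpha K_\beta)^c\,|\mathcal{P}|^{1-c}|\mathcal{L}|^{1-c},$$ where $I(\mathcal{P},\mathcal{L})$ is the number of pairs $(q,l)\in\mathcal{P}\times\mathcal{L}$ with $q\in l$.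
   Context: $R_k=\mathbb{Z}/p^k\mathbb{Z}$. A line in $R_k^2$ is a set $\{a+tb:t\in R_k\}$ with $a\in R_k^2$ and $b\in R_k^2$ having at least one invertible coordinate. For $0\le j\le k$, $\pi_j:R_k^2\to R_j^2$ is reduction mod $p^j$. A $p^{-j}$-cube in $R_k^2$ is a set $\{y\in R_k^2:p^j\mid(y-x)\}$ (both coordinates divisible), $x\in R_k^2$. A $p^{-j}$-tube in $R_k^2$ is a set $\pi_j^{-1}(\ell_j)$ for a line $\ell_j$ in $R_j^2$; for $j=0$ the only tube is $R_k^2$. Points of $R_k^2$ are the $p^{-k}$-cubes and lines in $R_k^2$ are the $p^{-k}$-tubes. A set of weighted points $\mathcal{P}$ (resp. lines $\mathcal{L}$) is a set of points with a weight function $w:\mathcal{P}\to\mathbb{N}$ (resp. a set of lines with $\omega:\mathcal{L}\to\mathbb{N}$). Put $|\mathcal{P}|_w=\sum_{q\in\mathcal{P}}w(q)$, $|\mathcal{L}|_w=\sum_{l\in\mathcal{L}}\omega(l)$ and $$I_w(\mathcal{P},\mathcal{L})=\sum_{q\in\mathcal{P}}\sum_{l\in\mathcal{L}}w(q)\omega(l)\mathbf{1}_{\{q\in l\}}.$$ $\mathcal{P}$ is a $(p^{-k},\alpha,K_\alpha)$-set if for every $0\le\ell\le k$ and every $p^{-\ell}$-cube $Q_\ell$ in $R_k^2$, $\sum_{q\in\mathcal{P},\,q\in Q_\ell}w(q)\le K_\alpha p^{\alpha(k-\ell)}$. $\mathcal{L}$ is a $(p^{-k},\beta,K_\beta)$-set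 if for every $0\le\ell\le k$ and every $p^{-\ell}$-tube $T_\ell$ in $R_k^2$, $\sum_{l\in\mathcal{L},\,l\subseteq T_\ell}\omega(l)\le K_\beta p^{\beta(k-\ell)}$. *)

theory Defs
  imports Complex_Main "HOL-Number_Theory.Residues"
begin

definition Zmod :: "nat \<Rightarrow> nat \<Rightarrow> int ring" where
  "Zmod p k = residue_ring (int p ^ k)"

definition plane :: "nat \<Rightarrow> nat \<Rightarrow> (int \<times> int) set" where
  "plane p k = carrier (Zmod p k) \<times> carrier (Zmod p k)"

text \<open>
  Lines are used only for \<open>k \<ge> 1\<close>: the record \<^term>\<open>residue_ring 1\<close> has carrier
  \<open>{0}\<close> but its field \<open>one\<close> is the integer \<open>1\<close>, so it has no units.
\<close>

definition lines :: "nat \<Rightarrow> nat \<Rightarrow> (int \<times> int) set set" where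
  "lines p k =
    {{(a1 \<oplus>\<^bsub>Zmod p k\<^esub> t \<otimes>\<^bsub>Zmod p k\<^esub> b1, a2 \<oplus>\<^bsub>Zmod p k\<^esub> t \<otimes>\<^bsub>Zmod p k\<^esub> b2)
        | t. t \<in> carrier (Zmod p k)}
      | a1 a2 b1 b2. (a1, a2) \<in> plane p k \<and> (b1, b2) \<in> plane p k \<and>
          (b1 \<in> Units (Zmod p k) \<or> b2 \<in> Units (Zmod p k))}"

definition reduction :: "nat \<Rightarrow> nat \<Rightarrow> int \<times> int \<Rightarrow> int \<times> int" where
  "reduction p j x = (fst x mod int p ^ j, snd x mod int p ^ j)"

definition cubes :: "nat \<Rightarrow> nat \<Rightarrow> nat \<Rightarrow> (int \<times> int) set set" where
  "cubes p k j =
    {{y \<in> plane p k. int p ^ j dvd fst y - fst x \<and> int p ^ j dvd snd y - snd x}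
      | x. x \<in> plane p k}"

definition tubes :: "nat \<Rightarrow> nat \<Rightarrow> nat \<Rightarrow> (int \<times> int) set set" where
  "tubes p k j =
    (if j = 0 then {plane p k}
     else {{y \<in> plane p k. reduction p j y \<in> l} | l. l \<in> lines p j})"

definition point_set ::
  "nat \<Rightarrow> nat \<Rightarrow> real \<Rightarrow> real \<Rightarrow> (int \<times> int) set \<Rightarrow> (int \<times> int \<Rightarrow> nat) \<Rightarrow> bool" where
  "point_set p k \<alpha> K P w \<longleftrightarrow>
    P \<subseteq> plane p k \<and>
    (\<forall>j\<le>k. \<forall>Q \<in> cubes p k j.
      real (\<Sum>q \<in> {q \<in> P. q \<in> Q}. w q) \<le> K * real p powr (\<alpha> * real (k - j)))"

definition line_set ::
  "nat \<Rightarrow> nat \<Rightarrow> real \<Rightarrow> real \<Rightarrow> (int \<times> int) set set \<Rightarrow> ((int \<times> int) set \<Rightarrow> nat) \<Rightarrow> bool" where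
  "line_set p k \<beta> K L \<omega> \<longleftrightarrow>
    L \<subseteq> lines p k \<and>
    (\<forall>j\<le>k. \<forall>T \<in> tubes p k j.
      real (\<Sum>l \<in> {l \<in> L. l \<subseteq> T}. \<omega> l) \<le> K * real p powr (\<beta> * real (k - j)))"

definition weighted_incidences ::
  "('a \<Rightarrow> nat) \<Rightarrow> ('a set \<Rightarrow> nat) \<Rightarrow> 'a set \<Rightarrow> 'a set set \<Rightarrow> nat" where
  "weighted_incidences w \<omega> P L = (\<Sum>q\<in>P. \<Sum>l\<in>L. w q * \<omega> l * of_bool (q \<in> l))"

end

theory Submission
  imports Defs "HOL-Analysis.Convex"
begin

text \<open>
  Write \<open>\<pi>\<close> for reduction from level \<open>k + 1\<close> to level \<open>k\<close>. The proof is a high-low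
  argument followed by induction on the scale. Every line \<open>l\<close> at level \<open>k + 1\<close> is split as

  \<open>1\<^sub>l(q) = h\<^sub>l(q) + 1/p \<cdot> [\<pi> q \<in> \<pi> l]\<close>.

  The second, low-frequency summand is the average of \<open>1\<^sub>l\<close> over the fibres of \<open>\<pi>\<close>; summed against
  the weights it is \<open>1/p\<close> times the number of incidences between the projected points and lines,
  with the weights pushed forward (\<open>incidences_coarsen\<close>). The pushed-forward families satisfy the
  same non-concentration hypotheses with \<open>K\<^sub>\<alpha>\<close>, \<open>K\<^sub>\<beta>\<close> replaced by \<open>p\<^sup>\<alpha> K\<^sub>\<alpha>\<close>, \<open>p\<^sup>\<beta> K\<^sub>\<beta>\<close>
  (\<open>spread_points_coarsen\<close>, \<open>spread_lines_coarsen\<close>) and have the same total weights.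

  The high-frequency summands \<open>h\<^sub>l\<close> are almost orthogonal. Since every point of \<open>\<pi> l\<close> has \<open>p\<close> lifts
  on \<open>l\<close> and \<open>p\<^sup>2\<close> lifts in the plane, the inner product of \<open>h\<^sub>l\<close> and \<open>h\<^sub>l'\<close> is
  \<open>card (l \<inter> l') - card (\<pi> l \<inter> \<pi> l')\<close> (\<open>oscillation_inner_product\<close>). For \<open>l = l'\<close> this is at most
  \<open>p\<close> to the power \<open>k + 1\<close>. For \<open>l \<noteq> l'\<close> it is at most \<open>0\<close>: two points common to distinct lines agree
  modulo \<open>p\<close>, so dilating \<open>l \<inter> l'\<close> by \<open>1/p\<close> about one of its points embeds it in \<open>\<pi> l \<inter> \<pi> l'\<close>
  (\<open>card_zline_inter_le\<close>). As weights are nonnegative, the off-diagonal terms can be dropped, and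
  the Cauchy-Schwarz inequality yields

  \<open>I\<^sub>k\<^sub>+\<^sub>1 \<le> sqrt (p\<^sup>k\<^sup>+\<^sup>1 K\<^sub>\<alpha> K\<^sub>\<beta> X) + I\<^sub>k / p\<close>,

  where \<open>X\<close> is the product of the two total weights (\<open>incidences_step\<close>).

  This recursion is closed in \<open>scale_recursion_closes\<close>. With \<open>Y = K\<^sub>\<alpha> K\<^sub>\<beta>\<close>, if
  \<open>X \<le> p\<^sup>k\<^sup>+\<^sup>1 Y\<close> then the trivial bound by \<open>X\<close> suffices. Otherwise \<open>c \<le> 1/2\<close> bounds the
  square root by \<open>(p\<^sup>k\<^sup>+\<^sup>1 Y)\<^sup>c X\<^sup>1\<^sup>-\<^sup>c\<close>, while \<open>c (\<alpha> + \<beta> - 1) \<le> 1\<close> makes the low term gain a factor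
  \<open>p\<^sup>-\<^sup>\<epsilon>\<close> over the desired bound. The two add up within the bound because
  \<open>C (p\<^sup>\<epsilon> - 1) \<ge> 1\<close>. The trivial bound also needs \<open>C \<ge> 1\<close>, which follows from \<open>C > p\<^sup>1\<^sup>-\<^sup>\<epsilon>\<close>.
\<close>

section \<open>Lines as solution sets of linear congruences\<close>

text \<open>
  Solution sets of primitive linear congruences make sense at every level including \<open>k = 0\<close>,
  where the parametric definition of lines degenerates, and they reduce modulo smaller powers
  of \<open>p\<close> with the same coefficients. This lets the induction start at \<open>k = 0\<close>.
\<close>

definition zline :: "nat \<Rightarrow> nat \<Rightarrow> int \<Rightarrow> int \<Rightarrow> int \<Rightarrow> (int \<times> int) set" where
  "zline p k n1 n2 n0 = {x \<in> plane p k. int p ^ k dvd n1 * fst x + n2 * snd x + n0}"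

definition primitive :: "nat \<Rightarrow> int \<Rightarrow> int \<Rightarrow> bool" where
  "primitive p u v \<longleftrightarrow> \<not> int p dvd u \<or> \<not> int p dvd v"

definition zlines :: "nat \<Rightarrow> nat \<Rightarrow> (int \<times> int) set set" where
  "zlines p k = {zline p k n1 n2 n0 | n1 n2 n0. primitive p n1 n2}"

lemma plane_eq: "plane p k = {0..<int p ^ k} \<times> {0..<int p ^ k}"
  by (auto simp: plane_def Zmod_def residue_ring_def)

lemma finite_plane [simp]: "finite (plane p k)"
  by (simp add: plane_eq)

lemma plane_0 [simp]: "plane p 0 = {(0, 0)}"
  by (auto simp: plane_eq)

lemma finite_zlines [simp]: "finite (zlines p k)"
  by (rule finite_subset[of _ "Pow (plane p k)"]) (auto simp: zlines_def zline_def)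

lemma reduction_in_plane: "prime p \<Longrightarrow> reduction p j x \<in> plane p j"
  using prime_gt_0_nat[of p] by (simp add: reduction_def plane_eq)

lemma coprime_prime_power_int:
  assumes "prime p" "\<not> int p dvd u" shows "coprime (int p ^ k) u"
proof -
  have "coprime (int p) u"
    using assms by (intro prime_imp_coprime) simp_all
  thus ?thesis by simp
qed

lemma dvd_affine_mod_iff:
  fixes q n1 n2 n0 x y :: int
  shows "q dvd n1 * (x mod q) + n2 * (y mod q) + n0 \<longleftrightarrow> q dvd n1 * x + n2 * y + n0"
  by (intro cong_dvd_iff cong_add cong_mult cong_refl cong_mod_leftI)

lemma primitive_cancel:
  assumes "prime p" "primitive p u v"
    and "int p ^ k dvd u * x" "int p ^ k dvd v * x"
  shows "int p ^ k dvd x"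
proof -
  from assms(2) consider "\<not> int p dvd u" | "\<not> int p dvd v" by (auto simp: primitive_def)
  thus ?thesis
    using coprime_prime_power_int[OF assms(1)] assms(3,4) by cases (simp_all add: coprime_dvd_mult_right_iff)
qed

text \<open>
  In the plane over a field, a nonzero \<open>d\<close> orthogonal to a nonzero \<open>n\<close> spans the orthogonal complement of \<open>n\<close>.
  The same holds modulo \<open>p\<^sup>k\<close> for primitive vectors: modulo \<open>n \<cdot> d\<close>, each entry of \<open>n\<close> times the
  determinant of \<open>d\<close> and \<open>e\<close> is a multiple of \<open>n \<cdot> e\<close>, and each entry of \<open>d\<close> times \<open>n \<cdot> e\<close> is a
  multiple of the determinant; one of the entries is a unit and can be cancelled.
\<close>

lemma orthogonal_iff_parallel:
  fixes n1 n2 d1 d2 e1 e2 :: int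
  assumes p: "prime p" and n: "primitive p n1 n2" and d: "primitive p d1 d2"
    and nd: "int p ^ k dvd n1 * d1 + n2 * d2"
  shows "int p ^ k dvd n1 * e1 + n2 * e2 \<longleftrightarrow> int p ^ k dvd d1 * e2 - d2 * e1"
proof
  assume a: "int p ^ k dvd n1 * e1 + n2 * e2"
  have "n1 * (d1 * e2 - d2 * e1) = e2 * (n1 * d1 + n2 * d2) - d2 * (n1 * e1 + n2 * e2)"
    and "n2 * (d1 * e2 - d2 * e1) = d1 * (n1 * e1 + n2 * e2) - e1 * (n1 * d1 + n2 * d2)"
    by (simp_all add: algebra_simps)
  hence "int p ^ k dvd n1 * (d1 * e2 - d2 * e1)" "int p ^ k dvd n2 * (d1 * e2 - d2 * e1)"
    by (simp_all only: dvd_diff dvd_mult a nd)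
  thus "int p ^ k dvd d1 * e2 - d2 * e1"
    by (rule primitive_cancel[OF p n])
next
  assume a: "int p ^ k dvd d1 * e2 - d2 * e1"
  have "d1 * (n1 * e1 + n2 * e2) = n2 * (d1 * e2 - d2 * e1) + e1 * (n1 * d1 + n2 * d2)"
    and "d2 * (n1 * e1 + n2 * e2) = e2 * (n1 * d1 + n2 * d2) - n1 * (d1 * e2 - d2 * e1)"
    by (simp_all add: algebra_simps)
  hence "int p ^ k dvd d1 * (n1 * e1 + n2 * e2)" "int p ^ k dvd d2 * (n1 * e1 + n2 * e2)"
    by (simp_all only: dvd_diff dvd_add dvd_mult a nd)
  thus "int p ^ k dvd n1 * e1 + n2 * e2"
    by (rule primitive_cancel[OF p d])
qed

lemma unit_inverse:
  assumes "prime p" "\<not> int p dvd u"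
  obtains i where "int p ^ k dvd i * u - 1"
proof -
  have "coprime u (int p ^ k)"
    using coprime_prime_power_int[OF assms] by (simp add: coprime_commute)
  then obtain i where "[u * i = 1] (mod int p ^ k)" using cong_solve_coprime_int by blast
  thus ?thesis using that by (simp add: cong_iff_dvd_diff mult.commute)
qed

lemma primitive_solvable:
  assumes p: "prime p" and n: "primitive p n1 n2"
  shows "\<exists>x y. int p ^ k dvd n1 * x + n2 * y + n0"
proof -
  have *: "\<exists>x. int p ^ k dvd u * x + n0" if u: "\<not> int p dvd u" for u
  proof -
    obtain i where "int p ^ k dvd i * u - 1" using unit_inverse[OF p u] .
    moreover have "u * (- n0 * i) + n0 = - n0 * (i * u - 1)" by (simp add: algebra_simps)
    ultimately show ?thesis by (metis dvd_mult)
  qed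
  from n consider "\<not> int p dvd n1" | "\<not> int p dvd n2" by (auto simp: primitive_def)
  thus ?thesis
  proof cases
    case 1
    then obtain x where "int p ^ k dvd n1 * x + n0" using * by blast
    thus ?thesis by (intro exI[of _ x] exI[of _ 0]) simp
  next
    case 2
    then obtain x where "int p ^ k dvd n2 * x + n0" using * by blast
    thus ?thesis by (intro exI[of _ 0] exI[of _ x]) simp
  qed
qed

lemma zline_cong:
  assumes "[n1 = m1] (mod int p ^ k)" "[n2 = m2] (mod int p ^ k)" "[n0 = m0] (mod int p ^ k)"
  shows "zline p k n1 n2 n0 = zline p k m1 m2 m0"
proof -
  have "[n1 * x + n2 * y + n0 = m1 * x + m2 * y + m0] (mod int p ^ k)" for x y
    using assms by (intro cong_add cong_mult cong_refl)
  hence "int p ^ k dvd n1 * x + n2 * y + n0 \<longleftrightarrow> int p ^ k dvd m1 * x + m2 * y + m0" for x y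
    by (rule cong_dvd_iff)
  thus ?thesis by (simp add: zline_def)
qed

lemma mem_zline_iff:
  assumes "x \<in> plane p k"
  shows "x \<in> zline p k n1 n2 n0 \<longleftrightarrow> int p ^ k dvd n1 * fst x + n2 * snd x + n0"
  using assms by (simp add: zline_def)

lemma reduction_zline:
  assumes p: "prime p" and x: "x \<in> zline p (Suc k) n1 n2 n0"
  shows "reduction p k x \<in> zline p k n1 n2 n0"
proof -
  have "int p ^ k dvd n1 * fst x + n2 * snd x + n0"
    using x by (auto simp: zline_def dest: dvd_mult_right)
  hence "int p ^ k dvd n1 * (fst x mod int p ^ k) + n2 * (snd x mod int p ^ k) + n0"
    by (simp add: dvd_affine_mod_iff)
  thus ?thesis
    using reduction_in_plane[OF p] by (simp add: mem_zline_iff) (simp add: reduction_def)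
qed

text \<open>
  The parameter of a point is recovered from its displacement by inverting a unit coordinate of
  the direction \<open>b\<close>.
\<close>

lemma zline_param:
  assumes p: "prime p" and b: "primitive p b1 b2"
  shows "zline p k b2 (- b1) (b1 * a2 - b2 * a1)
      = {((a1 + t * b1) mod int p ^ k, (a2 + t * b2) mod int p ^ k) | t. t \<in> {0..<int p ^ k}}"
    (is "?Z = ?A")
proof
  let ?q = "int p ^ k"
  have q: "?q > 0" using prime_gt_0_nat[OF p] by simp
  show "?A \<subseteq> ?Z"
  proof
    fix x assume "x \<in> ?A"
    then obtain t where x: "x = ((a1 + t * b1) mod ?q, (a2 + t * b2) mod ?q)" by auto
    have "b2 * (a1 + t * b1) + - b1 * (a2 + t * b2) + (b1 * a2 - b2 * a1) = 0"
      by (simp add: algebra_simps)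
    hence "?q dvd b2 * ((a1 + t * b1) mod ?q) + - b1 * ((a2 + t * b2) mod ?q)
        + (b1 * a2 - b2 * a1)"
      by (simp only: dvd_affine_mod_iff dvd_0_right)
    thus "x \<in> ?Z" using q by (simp add: zline_def x plane_eq)
  qed
  show "?Z \<subseteq> ?A"
  proof
    fix x assume xZ: "x \<in> ?Z"
    obtain x1 x2 where x: "x = (x1, x2)" by force
    have bd: "0 \<le> x1" "x1 < ?q" "0 \<le> x2" "x2 < ?q"
      and dv: "?q dvd b2 * (x1 - a1) - b1 * (x2 - a2)"
      using xZ by (auto simp: zline_def x plane_eq algebra_simps)
    have ex: "\<exists>s. ?q dvd s * b1 - (x1 - a1) \<and> ?q dvd s * b2 - (x2 - a2)"
    proof -
      from b consider "\<not> int p dvd b1" | "\<not> int p dvd b2" by (auto simp: primitive_def)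
      thus ?thesis
      proof cases
        case 1
        then obtain i where i: "?q dvd i * b1 - 1" using unit_inverse[OF p] by blast
        have "i * (x1 - a1) * b1 - (x1 - a1) = (x1 - a1) * (i * b1 - 1)"
          "i * (x1 - a1) * b2 - (x2 - a2)
             = i * (b2 * (x1 - a1) - b1 * (x2 - a2)) + (x2 - a2) * (i * b1 - 1)"
          by (simp_all add: algebra_simps)
        hence "?q dvd i * (x1 - a1) * b1 - (x1 - a1)" "?q dvd i * (x1 - a1) * b2 - (x2 - a2)"
          by (simp_all only: dvd_add dvd_mult i dv)
        thus ?thesis by blast
      next
        case 2
        then obtain i where i: "?q dvd i * b2 - 1" using unit_inverse[OF p] by blast
        have "i * (x2 - a2) * b2 - (x2 - a2) = (x2 - a2) * (i * b2 - 1)"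
          "i * (x2 - a2) * b1 - (x1 - a1)
             = (x1 - a1) * (i * b2 - 1) - i * (b2 * (x1 - a1) - b1 * (x2 - a2))"
          by (simp_all add: algebra_simps)
        hence "?q dvd i * (x2 - a2) * b1 - (x1 - a1)" "?q dvd i * (x2 - a2) * b2 - (x2 - a2)"
          by (simp_all only: dvd_diff dvd_mult i dv)
        thus ?thesis by blast
      qed
    qed
    then obtain s where s: "?q dvd s * b1 - (x1 - a1)" "?q dvd s * b2 - (x2 - a2)" by blast
    have "(a1 + s mod ?q * b1) mod ?q = (a1 + s * b1) mod ?q"
      "(a2 + s mod ?q * b2) mod ?q = (a2 + s * b2) mod ?q"
      unfolding cong_def[symmetric] by (intro cong_add cong_mult cong_refl cong_mod_leftI)+
    moreover have "(a1 + s * b1) mod ?q = x1 mod ?q" "(a2 + s * b2) mod ?q = x2 mod ?q"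
      using s by (simp_all add: mod_eq_dvd_iff algebra_simps)
    ultimately have "x = ((a1 + s mod ?q * b1) mod ?q, (a2 + s mod ?q * b2) mod ?q)"
      using bd x by simp
    moreover have "s mod ?q \<in> {0..<?q}" using q by simp
    ultimately show "x \<in> ?A" by blast
  qed
qed

lemma Units_Zmod_iff:
  assumes p: "prime p" and k: "k \<ge> 1" and x: "x \<in> carrier (Zmod p k)"
  shows "x \<in> Units (Zmod p k) \<longleftrightarrow> \<not> int p dvd x"
proof -
  have "int p ^ 1 \<le> int p ^ k" using prime_gt_1_nat[OF p] k by (intro power_increasing) auto
  moreover have "1 < int p" using prime_gt_1_nat[OF p] by simp
  ultimately have "residues (int p ^ k)" unfolding residues_def power_one_right by linarith
  then interpret residues "int p ^ k" "Zmod p k"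
    by (auto simp: Zmod_def)
  have "prime (int p)" using p by simp
  have iff: "coprime x (int p ^ k) \<longleftrightarrow> \<not> int p dvd x"
  proof
    assume "coprime x (int p ^ k)"
    hence "coprime x (int p)" using k by simp
    thus "\<not> int p dvd x"
      using \<open>prime (int p)\<close> by (metis coprime_absorb_right not_prime_unit)
  next
    assume "\<not> int p dvd x"
    thus "coprime x (int p ^ k)"
      using coprime_prime_power_int[OF p] by (simp add: coprime_commute)
  qed
  moreover have "x \<noteq> 0" if "\<not> int p dvd x" using that by auto
  ultimately show ?thesis using x by (auto simp: res_units_eq res_carrier_eq order.order_iff_strict)
qed

text \<open>
  A direction \<open>b\<close> corresponds to the normal vector \<open>(b\<^sub>2, -b\<^sub>1)\<close>; conversely a primitive congruence
  has a solution, which serves as the base point.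
\<close>

lemma lines_eq_zlines:
  assumes p: "prime p" and k: "k \<ge> 1"
  shows "lines p k = zlines p k"
proof
  let ?q = "int p ^ k"
  have q: "?q > 0" using prime_gt_0_nat[OF p] by simp
  have car: "carrier (Zmod p k) = {0..<?q}" by (auto simp: Zmod_def residue_ring_def)
  have ops: "x \<oplus>\<^bsub>Zmod p k\<^esub> t \<otimes>\<^bsub>Zmod p k\<^esub> y = (x + t * y) mod ?q" for x t y
    by (simp add: Zmod_def residue_ring_def mod_simps)
  have eq: "lines p k = {zline p k b2 (- b1) (b1 * a2 - b2 * a1) | a1 a2 b1 b2.
      (a1, a2) \<in> plane p k \<and> (b1, b2) \<in> plane p k \<and> primitive p b1 b2}" (is "_ = ?R")
  proof -
    have "(b1 \<in> Units (Zmod p k) \<or> b2 \<in> Units (Zmod p k)) \<longleftrightarrow> primitive p b1 b2"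
      if "(b1, b2) \<in> plane p k" for b1 b2
      using that Units_Zmod_iff[OF p k] by (auto simp: plane_def primitive_def)
    hence "lines p k = {{((a1 + t * b1) mod ?q, (a2 + t * b2) mod ?q) | t. t \<in> {0..<?q}} | a1 a2 b1 b2.
      (a1, a2) \<in> plane p k \<and> (b1, b2) \<in> plane p k \<and> primitive p b1 b2}"
      unfolding lines_def ops car
      by (intro Collect_cong iff_exI conj_cong[OF refl]) simp
    also have "\<dots> = ?R"
    proof -
      define F where "F a1 a2 b1 b2 =
          {((a1 + t * b1) mod ?q, (a2 + t * b2) mod ?q) | t. t \<in> {0..<?q}}" for a1 a2 b1 b2
      define G where "G a1 a2 b1 b2 = zline p k b2 (- b1) (b1 * a2 - b2 * a1)" for a1 a2 b1 b2
      have "F a1 a2 b1 b2 = G a1 a2 b1 b2" if "primitive p b1 b2" for a1 a2 b1 b2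
        unfolding F_def G_def using zline_param[OF p that] by simp
      thus ?thesis unfolding F_def[symmetric] G_def[symmetric] by (intro Collect_cong) metis
    qed
    finally show ?thesis .
  qed
  have neg: "primitive p b2 (- b1) \<longleftrightarrow> primitive p b1 b2" for b1 b2
    by (auto simp: primitive_def)
  show "lines p k \<subseteq> zlines p k"
    unfolding eq zlines_def using neg by blast
  show "zlines p k \<subseteq> lines p k"
  proof
    fix l assume "l \<in> zlines p k"
    then obtain n1 n2 n0 where l: "l = zline p k n1 n2 n0" and n: "primitive p n1 n2"
      by (auto simp: zlines_def)
    obtain a1 a2 where "?q dvd n1 * a1 + n2 * a2 + n0"
      using primitive_solvable[OF p n] by blast
    hence a: "?q dvd n1 * (a1 mod ?q) + n2 * (a2 mod ?q) + n0"
      by (simp add: dvd_affine_mod_iff)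
    define a1' a2' where "a1' = a1 mod ?q" and "a2' = a2 mod ?q"
    define b1 b2 where "b1 = (- n2) mod ?q" and "b2 = n1 mod ?q"
    have cong: "[b1 = - n2] (mod ?q)" "[b2 = n1] (mod ?q)"
      unfolding b1_def b2_def by (rule cong_mod_leftI[OF cong_refl])+
    have "[b1 * a2' - b2 * a1' = - n2 * a2' - n1 * a1'] (mod ?q)"
      using cong by (intro cong_diff cong_mult cong_refl)
    also have "[- n2 * a2' - n1 * a1' = n0] (mod ?q)"
    proof -
      have "n0 - (- n2 * a2' - n1 * a1') = n1 * a1' + n2 * a2' + n0" by simp
      hence "?q dvd n0 - (- n2 * a2' - n1 * a1')" using a unfolding a1'_def a2'_def by (simp only:)
      thus ?thesis unfolding cong_iff_dvd_diff by (simp only: dvd_diff_commute)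
    qed
    finally have c0: "[b1 * a2' - b2 * a1' = n0] (mod ?q)" .
    have "[- b1 = n2] (mod ?q)" using cong(1) cong_minus_minus_iff[of b1 "- n2"] by simp
    hence "l = zline p k b2 (- b1) (b1 * a2' - b2 * a1')"
      unfolding l using cong(2) c0 by (intro zline_cong) (simp_all only: cong_sym)
    moreover have "(a1', a2') \<in> plane p k" "(b1, b2) \<in> plane p k"
      using q by (simp_all add: a1'_def a2'_def b1_def b2_def plane_eq)
    moreover have "primitive p b1 b2"
    proof -
      have "int p dvd ?q" using k by simp
      hence "int p dvd b1 \<longleftrightarrow> int p dvd n2" "int p dvd b2 \<longleftrightarrow> int p dvd n1"
        by (simp_all add: b1_def b2_def dvd_mod_iff)
      thus ?thesis using n by (auto simp: primitive_def)
    qed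
    ultimately show "l \<in> lines p k" unfolding eq by blast
  qed
qed

section \<open>Lifting points and lines to the next scale\<close>

text \<open>
  Used with the two fibre sizes \<open>p\<close> (on a line) and \<open>p\<^sup>2\<close> (in the plane).
\<close>

lemma card_vimage_uniform_fibres:
  assumes "finite S" "finite B" "\<And>y. y \<in> B \<Longrightarrow> card {x \<in> S. f x = y} = m"
  shows "card {x \<in> S. f x \<in> B} = m * card B"
proof -
  have "{x \<in> S. f x \<in> B} = (\<Union>y\<in>B. {x \<in> S. f x = y})" by auto
  also have "card \<dots> = (\<Sum>y\<in>B. card {x \<in> S. f x = y})"
    using assms(1,2) by (intro card_UN_disjoint) auto
  also have "\<dots> = m * card B" using assms(3) by simp
  finally show ?thesis .
qed

lemma zline_eq_line_through:
  assumes "int p ^ k dvd n1 * a1 + n2 * a2 + n0"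
  shows "zline p k n1 n2 n0 = zline p k n1 (- (- n2)) ((- n2) * a2 - n1 * a1)"
proof (rule zline_cong)
  have "n0 - (- n2 * a2 - n1 * a1) = n1 * a1 + n2 * a2 + n0" by simp
  thus "[n0 = - n2 * a2 - n1 * a1] (mod int p ^ k)"
    using assms by (simp only: cong_iff_dvd_diff)
qed simp_all

text \<open>
  A primitive direction makes the parametrisation of a line injective.
\<close>

lemma card_zline:
  assumes p: "prime p" and n: "primitive p n1 n2"
  shows "card (zline p k n1 n2 n0) = p ^ k"
proof -
  let ?q = "int p ^ k"
  obtain a1 a2 where a: "?q dvd n1 * a1 + n2 * a2 + n0" using primitive_solvable[OF p n] by blast
  define b1 where "b1 = - n2"
  define g where "g t = ((a1 + t * b1) mod ?q, (a2 + t * n1) mod ?q)" for t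
  have b: "primitive p b1 n1" using n by (auto simp: primitive_def b1_def)
  have "zline p k n1 n2 n0 = zline p k n1 (- b1) (b1 * a2 - n1 * a1)"
    unfolding b1_def by (rule zline_eq_line_through[OF a])
  also have "\<dots> = g ` {0..<?q}"
    unfolding zline_param[OF p b] g_def by blast
  finally have im: "zline p k n1 n2 n0 = g ` {0..<?q}" .
  have "inj_on g {0..<?q}"
  proof (rule inj_onI)
    fix s t assume s: "s \<in> {0..<?q}" and t: "t \<in> {0..<?q}" and "g s = g t"
    hence e: "(a1 + s * b1) mod ?q = (a1 + t * b1) mod ?q" "(a2 + s * n1) mod ?q = (a2 + t * n1) mod ?q"
      by (simp_all add: g_def)
    have "a1 + s * b1 - (a1 + t * b1) = b1 * (s - t)" "a2 + s * n1 - (a2 + t * n1) = n1 * (s - t)"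
      by (simp_all add: algebra_simps)
    hence "?q dvd b1 * (s - t)" "?q dvd n1 * (s - t)"
      using e unfolding mod_eq_dvd_iff by (simp_all only:)
    hence "?q dvd s - t" by (rule primitive_cancel[OF p b])
    hence "s mod ?q = t mod ?q" by (simp only: mod_eq_dvd_iff)
    thus "s = t" using s t by simp
  qed
  thus ?thesis unfolding im by (simp add: card_image nat_power_eq)
qed

text \<open>
  The lifts of a point to the next level are indexed by the next base-\<open>p\<close> digits of its two
  coordinates.
\<close>

lemma lift_bij_betw:
  assumes p: "prime p" and y: "y \<in> plane p k"
  shows "bij_betw (\<lambda>z. (fst y + int p ^ k * fst z, snd y + int p ^ k * snd z)) (plane p 1)
           {x \<in> plane p (Suc k). reduction p k x = y}"
proof (rule bij_betwI[where g = "\<lambda>x. (fst x div int p ^ k, snd x div int p ^ k)"])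
  let ?q = "int p ^ k"
  have q: "?q > 0" using prime_gt_0_nat[OF p] by simp
  have up: "0 \<le> u + ?q * z \<and> u + ?q * z < ?q * int p" if "0 \<le> u" "u < ?q" "0 \<le> z" "z < int p" for u z
  proof
    show "0 \<le> u + ?q * z" using that q by simp
    have "u + ?q * z < ?q * (z + 1)" using that by (simp add: algebra_simps)
    also have "\<dots> \<le> ?q * int p" using that q by (intro mult_left_mono) auto
    finally show "u + ?q * z < ?q * int p" .
  qed
  have down: "0 \<le> x div ?q \<and> x div ?q < int p" if "0 \<le> x" "x < ?q * int p" for x
  proof
    show "0 \<le> x div ?q" using that q by (simp add: pos_imp_zdiv_nonneg_iff)
    have "?q * (x div ?q) + x mod ?q = x" "0 \<le> x mod ?q" using q by simp_all
    hence "?q * (x div ?q) < ?q * int p" using that by linarith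
    thus "x div ?q < int p" using q by (simp only: mult_less_cancel_left_pos)
  qed
  obtain u v where yv: "y = (u, v)" by force
  have uv: "0 \<le> u" "u < ?q" "0 \<le> v" "v < ?q" using y yv by (auto simp: plane_eq)
  show "(\<lambda>z. (fst y + ?q * fst z, snd y + ?q * snd z)) \<in> plane p 1 \<rightarrow>
          {x \<in> plane p (Suc k). reduction p k x = y}"
    using up uv by (auto simp: plane_eq yv reduction_def mult.commute)
  show "(\<lambda>x. (fst x div ?q, snd x div ?q)) \<in> {x \<in> plane p (Suc k). reduction p k x = y} \<rightarrow> plane p 1"
    using down by (auto simp: plane_eq mult.commute)
  show "(fst (fst y + ?q * fst z, snd y + ?q * snd z) div ?q,
         snd (fst y + ?q * fst z, snd y + ?q * snd z) div ?q) = z" for z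
    using q uv by (simp add: yv)
  show "(fst y + ?q * fst (fst x div ?q, snd x div ?q), snd y + ?q * snd (fst x div ?q, snd x div ?q)) = x"
    if "x \<in> {x \<in> plane p (Suc k). reduction p k x = y}" for x
    using that by (auto simp: reduction_def)
qed

lemma card_plane_fibre:
  assumes p: "prime p" and y: "y \<in> plane p k"
  shows "card {x \<in> plane p (Suc k). reduction p k x = y} = p\<^sup>2"
proof -
  have "card (plane p 1) = p\<^sup>2" by (simp add: plane_eq power2_eq_square)
  thus ?thesis using bij_betw_same_card[OF lift_bij_betw[OF p y]] by simp
qed

text \<open>
  Hensel lifting: writing a lift as \<open>y + p\<^sup>k z\<close> and dividing the congruence by \<open>p\<^sup>k\<close> leaves a
  primitive linear congruence modulo \<open>p\<close> for the digit vector \<open>z\<close>, that is, a line in the plane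
  over the field with \<open>p\<close> elements.
\<close>

lemma card_zline_fibre:
  assumes p: "prime p" and n: "primitive p n1 n2" and y: "y \<in> zline p k n1 n2 n0"
  shows "card {x \<in> zline p (Suc k) n1 n2 n0. reduction p k x = y} = p"
proof -
  let ?q = "int p ^ k"
  let ?g = "\<lambda>z. (fst y + ?q * fst z, snd y + ?q * snd z)"
  have q: "?q > 0" using prime_gt_0_nat[OF p] by simp
  have yp: "y \<in> plane p k" using y by (simp add: zline_def)
  obtain m where m: "n1 * fst y + n2 * snd y + n0 = ?q * m" using y by (auto simp: zline_def)
  note bij = lift_bij_betw[OF p yp]
  have iff: "?g z \<in> zline p (Suc k) n1 n2 n0 \<longleftrightarrow> z \<in> zline p 1 n1 n2 m" if z: "z \<in> plane p 1" for z
  proof -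
    have "?g z \<in> plane p (Suc k)" using bij_betwE[OF bij] z by auto
    hence "?g z \<in> zline p (Suc k) n1 n2 n0 \<longleftrightarrow>
        ?q * int p dvd n1 * (fst y + ?q * fst z) + n2 * (snd y + ?q * snd z) + n0"
      by (simp add: mem_zline_iff mult.commute)
    also have "n1 * (fst y + ?q * fst z) + n2 * (snd y + ?q * snd z) + n0
        = (n1 * fst y + n2 * snd y + n0) + ?q * (n1 * fst z + n2 * snd z)"
      by (simp add: algebra_simps)
    also have "\<dots> = ?q * (n1 * fst z + n2 * snd z + m)"
      unfolding m by (simp add: algebra_simps)
    also have "?q * int p dvd \<dots> \<longleftrightarrow> int p dvd n1 * fst z + n2 * snd z + m"
      using q by (simp only: dvd_times_left_cancel_iff) 
    also have "\<dots> \<longleftrightarrow> z \<in> zline p 1 n1 n2 m" using z by (simp add: mem_zline_iff)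
    finally show ?thesis .
  qed
  have "bij_betw ?g (zline p 1 n1 n2 m) {x \<in> zline p (Suc k) n1 n2 n0. reduction p k x = y}"
  proof (rule bij_betw_subset[OF bij])
    show sub: "zline p 1 n1 n2 m \<subseteq> plane p 1" by (auto simp: zline_def)
    have "{x \<in> zline p (Suc k) n1 n2 n0. reduction p k x = y}
        = {x \<in> ?g ` plane p 1. x \<in> zline p (Suc k) n1 n2 n0}"
      unfolding bij_betw_imp_surj_on[OF bij] by (auto simp: zline_def)
    also have "\<dots> = ?g ` zline p 1 n1 n2 m"
      using iff sub by blast
    finally show "?g ` zline p 1 n1 n2 m = {x \<in> zline p (Suc k) n1 n2 n0. reduction p k x = y}" ..
  qed
  thus ?thesis using bij_betw_same_card card_zline[OF p n, of 1 m] by fastforce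
qed

lemma reduction_image_zline:
  assumes p: "prime p" and n: "primitive p n1 n2"
  shows "reduction p k ` zline p (Suc k) n1 n2 n0 = zline p k n1 n2 n0"
proof
  show "reduction p k ` zline p (Suc k) n1 n2 n0 \<subseteq> zline p k n1 n2 n0"
    using reduction_zline[OF p] by blast
  show "zline p k n1 n2 n0 \<subseteq> reduction p k ` zline p (Suc k) n1 n2 n0"
  proof
    fix y assume "y \<in> zline p k n1 n2 n0"
    hence "card {x \<in> zline p (Suc k) n1 n2 n0. reduction p k x = y} \<noteq> 0"
      using card_zline_fibre[OF p n] prime_gt_0_nat[OF p] by simp
    hence "{x \<in> zline p (Suc k) n1 n2 n0. reduction p k x = y} \<noteq> {}" by force
    thus "y \<in> reduction p k ` zline p (Suc k) n1 n2 n0" by blast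
  qed
qed

section \<open>Intersections of two lines at consecutive scales\<close>

text \<open>
  Two points that differ modulo \<open>p\<close> lie on at most one line: the right-hand side does not mention
  the coefficients of the congruence.
\<close>

lemma zline_determined:
  assumes p: "prime p" and n: "primitive p n1 n2"
    and x: "x \<in> zline p k n1 n2 n0" and y: "y \<in> zline p k n1 n2 n0"
    and d: "primitive p (fst y - fst x) (snd y - snd x)"
  shows "zline p k n1 n2 n0 = {z \<in> plane p k.
    int p ^ k dvd (fst y - fst x) * (snd z - snd x) - (snd y - snd x) * (fst z - fst x)}"
proof -
  let ?q = "int p ^ k"
  have x': "?q dvd n1 * fst x + n2 * snd x + n0" and y': "?q dvd n1 * fst y + n2 * snd y + n0"
    using x y by (auto simp: zline_def)
  have diff: "n1 * (fst z - fst x) + n2 * (snd z - snd x)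
      = (n1 * fst z + n2 * snd z + n0) - (n1 * fst x + n2 * snd x + n0)" for z :: "int \<times> int"
    by (simp add: algebra_simps)
  have "?q dvd n1 * (fst y - fst x) + n2 * (snd y - snd x)"
    unfolding diff using x' y' by (rule dvd_diff[rotated])
  note iff = orthogonal_iff_parallel[OF p n d this]
  have "?q dvd n1 * fst z + n2 * snd z + n0 \<longleftrightarrow>
      ?q dvd (fst y - fst x) * (snd z - snd x) - (snd y - snd x) * (fst z - fst x)" for z :: "int \<times> int"
    unfolding iff[symmetric] diff using x' by (metis dvd_diff_right_iff dvd_diff_commute dvd_diff_left_iff)
  thus ?thesis unfolding zline_def by simp
qed

text \<open>
  Fix a common point \<open>x\<close>. Any other common point \<open>y\<close> agrees with \<open>x\<close> modulo \<open>p\<close>, since the lines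
  are distinct. Hence \<open>x + (y - x) / p\<close> is defined; it is determined modulo \<open>p\<^sup>k\<close>, lies on both
  reduced lines, and determines \<open>y\<close> modulo \<open>p\<close> to the power \<open>k + 1\<close>. Plain reduction of \<open>y\<close> would
  not be injective.
\<close>

lemma card_zline_inter_le:
  assumes p: "prime p" and n: "primitive p n1 n2" and m: "primitive p m1 m2"
    and ne: "zline p (Suc k) n1 n2 n0 \<noteq> zline p (Suc k) m1 m2 m0"
  shows "card (zline p (Suc k) n1 n2 n0 \<inter> zline p (Suc k) m1 m2 m0)
       \<le> card (zline p k n1 n2 n0 \<inter> zline p k m1 m2 m0)"
    (is "card (?l \<inter> ?l') \<le> card (?m \<inter> ?m')")
proof (cases "?l \<inter> ?l' = {}")
  case False
  then obtain x where x: "x \<in> ?l" "x \<in> ?l'" by auto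
  have p0: "int p > 0" using prime_gt_0_nat[OF p] by simp
  let ?q = "int p ^ k"
  have close: "int p dvd fst y - fst x \<and> int p dvd snd y - snd x" if "y \<in> ?l \<inter> ?l'" for y
  proof (rule ccontr)
    assume "\<not> ?thesis"
    hence d: "primitive p (fst y - fst x) (snd y - snd x)" by (auto simp: primitive_def)
    have "?l = ?l'"
      using zline_determined[OF p n x(1) _ d] zline_determined[OF p m x(2) _ d] that by auto
    thus False using ne by simp
  qed
  define f where "f y = ((fst x + (fst y - fst x) div int p) mod ?q,
                         (snd x + (snd y - snd x) div int p) mod ?q)" for y
  have "inj_on f (?l \<inter> ?l')"
  proof (rule inj_onI)
    fix y z assume y: "y \<in> ?l \<inter> ?l'" and z: "z \<in> ?l \<inter> ?l'" and "f y = f z"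
    have *: "v = w" if c: "int p dvd v - u" "int p dvd w - u"
      and e: "(u + (v - u) div int p) mod ?q = (u + (w - u) div int p) mod ?q"
      and vw: "v \<in> {0..<int p ^ Suc k}" "w \<in> {0..<int p ^ Suc k}" for u v w
    proof -
      obtain v' w' where v': "v - u = int p * v'" and w': "w - u = int p * w'"
        using c by (auto elim!: dvdE)
      have "?q dvd (u + v') - (u + w')" using e p0 unfolding v' w' mod_eq_dvd_iff by simp
      hence "int p * ?q dvd int p * (v' - w')" by simp
      also have "int p * (v' - w') = v - w" using v' w' by (simp add: algebra_simps)
      finally have "v mod int p ^ Suc k = w mod int p ^ Suc k" by (simp add: mod_eq_dvd_iff)
      thus "v = w" using vw by simp
    qed
    have "y \<in> plane p (Suc k)" "z \<in> plane p (Suc k)" using y z by (auto simp: zline_def)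
    hence b: "fst y \<in> {0..<int p ^ Suc k}" "fst z \<in> {0..<int p ^ Suc k}"
      "snd y \<in> {0..<int p ^ Suc k}" "snd z \<in> {0..<int p ^ Suc k}" by (auto simp: plane_eq)
    have e: "(fst x + (fst y - fst x) div int p) mod ?q = (fst x + (fst z - fst x) div int p) mod ?q"
      "(snd x + (snd y - snd x) div int p) mod ?q = (snd x + (snd z - snd x) div int p) mod ?q"
      using \<open>f y = f z\<close> by (simp_all add: f_def)
    have "fst y = fst z"
      by (rule *[OF _ _ e(1) b(1) b(2)]) (use close[OF y] close[OF z] in auto)
    moreover have "snd y = snd z"
      by (rule *[OF _ _ e(2) b(3) b(4)]) (use close[OF y] close[OF z] in auto)
    ultimately show "y = z" by (rule prod_eqI)
  qed
  moreover have "f ` (?l \<inter> ?l') \<subseteq> ?m \<inter> ?m'"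
  proof -
    have "f y \<in> zline p k r1 r2 r0"
      if y: "y \<in> ?l \<inter> ?l'" "y \<in> zline p (Suc k) r1 r2 r0" and x: "x \<in> zline p (Suc k) r1 r2 r0"
      for y r1 r2 r0
    proof -
      obtain v w where vw: "fst y - fst x = int p * v" "snd y - snd x = int p * w"
        using close[OF y(1)] by (auto elim!: dvdE)
      have hx: "int p * ?q dvd r1 * fst x + r2 * snd x + r0"
        and hy: "int p * ?q dvd r1 * fst y + r2 * snd y + r0"
        using x y(2) by (auto simp: zline_def)
      have "int p * (r1 * v + r2 * w) = r1 * (fst y - fst x) + r2 * (snd y - snd x)"
        unfolding vw by (simp add: algebra_simps)
      also have "\<dots> = (r1 * fst y + r2 * snd y + r0) - (r1 * fst x + r2 * snd x + r0)"
        by (simp add: algebra_simps)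
      finally have "int p * ?q dvd int p * (r1 * v + r2 * w)"
        using dvd_diff[OF hy hx] by (simp only:)
      hence "?q dvd r1 * v + r2 * w" using p0 by simp
      moreover have "?q dvd r1 * fst x + r2 * snd x + r0" using hx by (rule dvd_mult_right)
      moreover have "r1 * (fst x + v) + r2 * (snd x + w) + r0
          = (r1 * fst x + r2 * snd x + r0) + (r1 * v + r2 * w)" by (simp add: algebra_simps)
      ultimately have "?q dvd r1 * (fst x + v) + r2 * (snd x + w) + r0" by (simp only: dvd_add)
      hence "?q dvd r1 * ((fst x + v) mod ?q) + r2 * ((snd x + w) mod ?q) + r0"
        by (simp only: dvd_affine_mod_iff)
      moreover have "f y = ((fst x + v) mod ?q, (snd x + w) mod ?q)"
        using p0 by (simp add: f_def vw)
      ultimately show ?thesis using p0 by (simp add: zline_def plane_eq)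
    qed
    thus ?thesis using x by blast
  qed
  moreover have "finite (?m \<inter> ?m')" by (simp add: zline_def)
  ultimately show ?thesis by (rule card_inj_on_le)
qed simp

section \<open>Incidences under coarsening\<close>

definition pushforward :: "('a \<Rightarrow> 'b) \<Rightarrow> 'a set \<Rightarrow> ('a \<Rightarrow> real) \<Rightarrow> 'b \<Rightarrow> real" where
  "pushforward f S w y = sum w {x \<in> S. f x = y}"

lemma pushforward_nonneg: "(\<And>x. x \<in> S \<Longrightarrow> 0 \<le> w x) \<Longrightarrow> 0 \<le> pushforward f S w y"
  unfolding pushforward_def by (rule sum_nonneg) simp

lemma sum_pushforward:
  assumes "finite S" "finite T" "f ` S \<subseteq> T"
  shows "(\<Sum>y\<in>T. pushforward f S w y * \<phi> y) = (\<Sum>x\<in>S. w x * \<phi> (f x))"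
proof -
  have "(\<Sum>y\<in>T. pushforward f S w y * \<phi> y) = (\<Sum>y\<in>T. \<Sum>x\<in>{x \<in> S. f x = y}. w x * \<phi> (f x))"
    by (simp add: pushforward_def sum_distrib_right)
  also have "\<dots> = (\<Sum>x\<in>S. w x * \<phi> (f x))" by (rule sum.group[OF assms])
  finally show ?thesis .
qed

lemma sum_pushforward_subset:
  assumes "finite S" "finite T" "f ` S \<subseteq> T" "B \<subseteq> T"
  shows "sum (pushforward f S w) B = sum w {x \<in> S. f x \<in> B}"
proof -
  have "sum (pushforward f S w) B = (\<Sum>y\<in>T. pushforward f S w y * of_bool (y \<in> B))"
    using assms(2,4) by (intro sum.mono_neutral_cong_left) auto
  also have "\<dots> = (\<Sum>x\<in>S. w x * of_bool (f x \<in> B))" by (rule sum_pushforward[OF assms(1-3)])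
  also have "\<dots> = sum w {x \<in> S. f x \<in> B}"
    using assms(1) by (intro sum.mono_neutral_cong_right) auto
  finally show ?thesis .
qed

definition incidences :: "nat \<Rightarrow> nat \<Rightarrow> (int \<times> int \<Rightarrow> real) \<Rightarrow> ((int \<times> int) set \<Rightarrow> real) \<Rightarrow> real" where
  "incidences p k w \<omega> = (\<Sum>q\<in>plane p k. w q * (\<Sum>l\<in>zlines p k. \<omega> l * of_bool (q \<in> l)))"

abbreviation coarsen_points :: "nat \<Rightarrow> nat \<Rightarrow> (int \<times> int \<Rightarrow> real) \<Rightarrow> int \<times> int \<Rightarrow> real" where
  "coarsen_points p k \<equiv> pushforward (reduction p k) (plane p (Suc k))"

abbreviation coarsen_lines ::
  "nat \<Rightarrow> nat \<Rightarrow> ((int \<times> int) set \<Rightarrow> real) \<Rightarrow> (int \<times> int) set \<Rightarrow> real" where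
  "coarsen_lines p k \<equiv> pushforward ((`) (reduction p k)) (zlines p (Suc k))"

lemma reduction_zlines:
  assumes p: "prime p" shows "(`) (reduction p k) ` zlines p (Suc k) \<subseteq> zlines p k"
  using reduction_image_zline[OF p] by (fastforce simp: zlines_def)

lemma reduction_plane: "prime p \<Longrightarrow> reduction p k ` plane p (Suc k) \<subseteq> plane p k"
  using reduction_in_plane by blast

lemma incidences_coarsen:
  assumes p: "prime p"
  shows "incidences p k (coarsen_points p k w) (coarsen_lines p k \<omega>)
    = (\<Sum>q\<in>plane p (Suc k). w q *
        (\<Sum>l\<in>zlines p (Suc k). \<omega> l * of_bool (reduction p k q \<in> reduction p k ` l)))"
  unfolding incidences_def
  by (simp only: sum_pushforward[OF finite_plane finite_plane reduction_plane[OF p]]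
      sum_pushforward[OF finite_zlines finite_zlines reduction_zlines[OF p]])

section \<open>Almost orthogonality of oscillations\<close>

text \<open>
  The high-frequency part of the indicator of a line: the indicator minus its average over the
  fibres of the reduction map. Each fibre over the reduced line has \<open>p\<^sup>2\<close> points, \<open>p\<close> of them on
  the line, so the average is \<open>1 / p\<close> there.
\<close>

definition oscillation :: "nat \<Rightarrow> nat \<Rightarrow> (int \<times> int) set \<Rightarrow> int \<times> int \<Rightarrow> real" where
  "oscillation p k l q = of_bool (q \<in> l) - of_bool (reduction p k q \<in> reduction p k ` l) / real p"

lemma sum_of_bool_card:
  "finite S \<Longrightarrow> (\<Sum>q\<in>S. of_bool (P q)) = real (card {q \<in> S. P q})"
  by (simp add: Int_def)

text \<open>
  Expanding the product gives four counts over \<open>B = \<pi> l \<inter> \<pi> l'\<close>. The two mixed terms contribute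
  \<open>card B\<close> each because \<open>B\<close> has \<open>p \<cdot> card B\<close> lifts on each line, and the product of the averages
  contributes \<open>card B\<close> because \<open>B\<close> has \<open>p\<^sup>2 \<cdot> card B\<close> lifts in the plane; one copy of \<open>- card B\<close>
  survives.
\<close>

lemma oscillation_inner_product:
  assumes p: "prime p" and l: "l \<in> zlines p (Suc k)" and l': "l' \<in> zlines p (Suc k)"
  shows "(\<Sum>q\<in>plane p (Suc k). oscillation p k l q * oscillation p k l' q)
    = real (card (l \<inter> l')) - real (card (reduction p k ` l \<inter> reduction p k ` l'))"
proof -
  let ?\<pi> = "reduction p k" and ?S = "plane p (Suc k)"
  define B where "B = ?\<pi> ` l \<inter> ?\<pi> ` l'"
  have p0: "real p > 0" using prime_gt_0_nat[OF p] by simp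
  have sub: "m \<subseteq> ?S" if "m \<in> zlines p (Suc k)" for m
    using that by (auto simp: zlines_def zline_def)
  have B: "finite B" "B \<subseteq> plane p k"
    using finite_subset[OF sub[OF l]] reduction_in_plane[OF p] by (auto simp: B_def)
  have on_line: "real (card {q \<in> ?S. q \<in> m \<and> ?\<pi> q \<in> B}) = real p * real (card B)"
    if m: "m \<in> zlines p (Suc k)" and Bm: "B \<subseteq> ?\<pi> ` m" for m
  proof -
    obtain n1 n2 n0 where mn: "m = zline p (Suc k) n1 n2 n0" "primitive p n1 n2"
      using m by (auto simp: zlines_def)
    have "card {q \<in> m. ?\<pi> q \<in> B} = p * card B"
    proof (rule card_vimage_uniform_fibres)
      fix y assume "y \<in> B"
      hence "y \<in> zline p k n1 n2 n0" using Bm reduction_image_zline[OF p mn(2)] mn(1) by blast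
      thus "card {x \<in> m. ?\<pi> x = y} = p" unfolding mn(1) by (rule card_zline_fibre[OF p mn(2)])
    qed (use finite_subset[OF sub[OF m]] B in simp_all)
    moreover have "{q \<in> ?S. q \<in> m \<and> ?\<pi> q \<in> B} = {q \<in> m. ?\<pi> q \<in> B}" using sub[OF m] by auto
    ultimately show ?thesis by simp
  qed
  have in_plane: "real (card {q \<in> ?S. ?\<pi> q \<in> B}) = (real p)\<^sup>2 * real (card B)"
  proof -
    have "card {q \<in> ?S. ?\<pi> q \<in> B} = p\<^sup>2 * card B"
      by (rule card_vimage_uniform_fibres[OF finite_plane B(1)])
        (rule card_plane_fibre[OF p], use B(2) in blast)
    thus ?thesis by simp
  qed
  have "oscillation p k l q * oscillation p k l' q = of_bool (q \<in> l \<inter> l')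
      - of_bool (q \<in> l \<and> ?\<pi> q \<in> B) / real p - of_bool (q \<in> l' \<and> ?\<pi> q \<in> B) / real p
      + of_bool (?\<pi> q \<in> B) / (real p)\<^sup>2" for q
  proof -
    have expand: "(a - b / real p) * (a' - b' / real p)
        = a * a' - a * b' / real p - a' * b / real p + b * b' / (real p)\<^sup>2" for a b a' b' :: real
      by (simp add: power2_eq_square algebra_simps)
    have "of_bool (q \<in> l) * of_bool (q \<in> l') = (of_bool (q \<in> l \<inter> l') :: real)"
      "of_bool (q \<in> l) * of_bool (?\<pi> q \<in> ?\<pi> ` l') = (of_bool (q \<in> l \<and> ?\<pi> q \<in> B) :: real)"
      "of_bool (q \<in> l') * of_bool (?\<pi> q \<in> ?\<pi> ` l) = (of_bool (q \<in> l' \<and> ?\<pi> q \<in> B) :: real)"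
      "of_bool (?\<pi> q \<in> ?\<pi> ` l) * of_bool (?\<pi> q \<in> ?\<pi> ` l') = (of_bool (?\<pi> q \<in> B) :: real)"
      by (auto simp: B_def)
    thus ?thesis unfolding oscillation_def expand by (simp only:)
  qed
  hence "(\<Sum>q\<in>?S. oscillation p k l q * oscillation p k l' q)
      = real (card {q \<in> ?S. q \<in> l \<inter> l'}) - real (card {q \<in> ?S. q \<in> l \<and> ?\<pi> q \<in> B}) / real p
        - real (card {q \<in> ?S. q \<in> l' \<and> ?\<pi> q \<in> B}) / real p
        + real (card {q \<in> ?S. ?\<pi> q \<in> B}) / (real p)\<^sup>2"
    by (simp only: sum.distrib sum_subtractf sum_divide_distrib[symmetric] sum_of_bool_card finite_plane)
  also have "{q \<in> ?S. q \<in> l \<inter> l'} = l \<inter> l'" using sub[OF l] by auto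
  also have "real (card {q \<in> ?S. q \<in> l \<and> ?\<pi> q \<in> B}) = real p * real (card B)"
    by (rule on_line[OF l]) (simp add: B_def)
  also have "real (card {q \<in> ?S. q \<in> l' \<and> ?\<pi> q \<in> B}) = real p * real (card B)"
    by (rule on_line[OF l']) (simp add: B_def)
  also note in_plane
  finally show ?thesis using p0 by (simp add: B_def power2_eq_square)
qed

lemma oscillation_norm_le:
  assumes p: "prime p" and l: "l \<in> zlines p (Suc k)"
  shows "(\<Sum>q\<in>plane p (Suc k). oscillation p k l q * oscillation p k l q) \<le> real p ^ Suc k"
proof -
  obtain n1 n2 n0 where "l = zline p (Suc k) n1 n2 n0" "primitive p n1 n2"
    using l by (auto simp: zlines_def)
  hence "card l = p ^ Suc k" using card_zline[OF p] by blast
  thus ?thesis unfolding oscillation_inner_product[OF p l l] by simp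
qed

lemma oscillation_inner_nonpos:
  assumes p: "prime p" and l: "l \<in> zlines p (Suc k)" and l': "l' \<in> zlines p (Suc k)" and ne: "l \<noteq> l'"
  shows "(\<Sum>q\<in>plane p (Suc k). oscillation p k l q * oscillation p k l' q) \<le> 0"
proof -
  obtain n1 n2 n0 where n: "l = zline p (Suc k) n1 n2 n0" "primitive p n1 n2"
    using l by (auto simp: zlines_def)
  obtain m1 m2 m0 where m: "l' = zline p (Suc k) m1 m2 m0" "primitive p m1 m2"
    using l' by (auto simp: zlines_def)
  have "card (l \<inter> l') \<le> card (reduction p k ` l \<inter> reduction p k ` l')"
    unfolding n(1) m(1) reduction_image_zline[OF p n(2)] reduction_image_zline[OF p m(2)]
    by (rule card_zline_inter_le[OF p n(2) m(2)]) (use ne n m in simp)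
  thus ?thesis unfolding oscillation_inner_product[OF p l l'] by simp
qed

text \<open>
  The off-diagonal inner products are nonpositive but need not vanish, for instance for parallel
  lines with the same reduction; nonnegativity of the weights allows them to be dropped.
\<close>

lemma oscillation_sum_norm_le:
  assumes p: "prime p" and \<omega>: "\<And>l. l \<in> zlines p (Suc k) \<Longrightarrow> 0 \<le> \<omega> l"
  shows "(\<Sum>q\<in>plane p (Suc k). (\<Sum>l\<in>zlines p (Suc k). \<omega> l * oscillation p k l q)\<^sup>2)
     \<le> real p ^ Suc k * (\<Sum>l\<in>zlines p (Suc k). (\<omega> l)\<^sup>2)"
proof -
  let ?L = "zlines p (Suc k)" and ?S = "plane p (Suc k)" and ?h = "oscillation p k"
  have "(\<Sum>q\<in>?S. (\<Sum>l\<in>?L. \<omega> l * ?h l q)\<^sup>2)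
      = (\<Sum>q\<in>?S. \<Sum>l\<in>?L. \<Sum>l'\<in>?L. \<omega> l * \<omega> l' * (?h l q * ?h l' q))"
    by (simp add: power2_eq_square sum_product algebra_simps)
  also have "\<dots> = (\<Sum>l\<in>?L. \<Sum>q\<in>?S. \<Sum>l'\<in>?L. \<omega> l * \<omega> l' * (?h l q * ?h l' q))"
    by (rule sum.swap)
  also have "\<dots> = (\<Sum>l\<in>?L. \<Sum>l'\<in>?L. \<Sum>q\<in>?S. \<omega> l * \<omega> l' * (?h l q * ?h l' q))"
    by (intro sum.cong refl sum.swap)
  also have "\<dots> = (\<Sum>l\<in>?L. \<Sum>l'\<in>?L. \<omega> l * \<omega> l' * (\<Sum>q\<in>?S. ?h l q * ?h l' q))"
    by (simp only: sum_distrib_left)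
  also have "\<dots> \<le> (\<Sum>l\<in>?L. \<Sum>l'\<in>?L. if l = l' then (\<omega> l)\<^sup>2 * real p ^ Suc k else 0)"
  proof (intro sum_mono)
    fix l l' assume l: "l \<in> ?L" "l' \<in> ?L"
    show "\<omega> l * \<omega> l' * (\<Sum>q\<in>?S. ?h l q * ?h l' q) \<le> (if l = l' then (\<omega> l)\<^sup>2 * real p ^ Suc k else 0)"
    proof (cases "l = l'")
      case True
      have "(\<omega> l)\<^sup>2 * (\<Sum>q\<in>?S. ?h l q * ?h l q) \<le> (\<omega> l)\<^sup>2 * real p ^ Suc k"
        by (intro mult_left_mono oscillation_norm_le[OF p l(1)]) simp
      thus ?thesis using True by (simp add: power2_eq_square)
    next
      case False
      thus ?thesis using oscillation_inner_nonpos[OF p l False] \<omega> l by (simp add: mult_nonneg_nonpos)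
    qed
  qed
  also have "\<dots> = real p ^ Suc k * (\<Sum>l\<in>?L. (\<omega> l)\<^sup>2)"
    by (simp add: sum_distrib_left mult.commute)
  finally show ?thesis .
qed

text \<open>
  The high-low inequality. The pointwise bounds \<open>A\<close> and \<open>B\<close> turn sums of squared weights, which
  come out of the Cauchy-Schwarz inequality, into total weights.
\<close>

lemma incidences_step:
  assumes p: "prime p" and w: "\<And>q. q \<in> plane p (Suc k) \<Longrightarrow> 0 \<le> w q \<and> w q \<le> A"
    and \<omega>: "\<And>l. l \<in> zlines p (Suc k) \<Longrightarrow> 0 \<le> \<omega> l \<and> \<omega> l \<le> B"
    and AB: "0 \<le> A" "0 \<le> B"
  shows "incidences p (Suc k) w \<omega>
    \<le> sqrt (real p ^ Suc k * (A * B) * (sum w (plane p (Suc k)) * sum \<omega> (zlines p (Suc k))))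
      + incidences p k (coarsen_points p k w) (coarsen_lines p k \<omega>) / real p"
proof -
  let ?L = "zlines p (Suc k)" and ?S = "plane p (Suc k)"
  define F where "F q = (\<Sum>l\<in>?L. \<omega> l * oscillation p k l q)" for q
  have split: "incidences p (Suc k) w \<omega> = (\<Sum>q\<in>?S. w q * F q)
      + incidences p k (coarsen_points p k w) (coarsen_lines p k \<omega>) / real p"
    unfolding incidences_coarsen[OF p] incidences_def[of p "Suc k"] F_def oscillation_def
      sum_divide_distrib sum.distrib[symmetric]
    by (intro sum.cong refl)
      (simp only: right_diff_distrib sum_subtractf times_divide_eq_right
        sum_divide_distrib[symmetric] diff_add_cancel)
  have w2: "(\<Sum>q\<in>?S. (w q)\<^sup>2) \<le> A * sum w ?S"
    unfolding sum_distrib_left power2_eq_square using w by (intro sum_mono mult_right_mono) auto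
  have \<omega>2: "(\<Sum>l\<in>?L. (\<omega> l)\<^sup>2) \<le> B * sum \<omega> ?L"
    unfolding sum_distrib_left power2_eq_square using \<omega> by (intro sum_mono mult_right_mono) auto
  have "(\<Sum>q\<in>?S. w q * F q)\<^sup>2 \<le> (\<Sum>q\<in>?S. (w q)\<^sup>2) * (\<Sum>q\<in>?S. (F q)\<^sup>2)"
    by (rule Cauchy_Schwarz_ineq_sum)
  also have "\<dots> \<le> (A * sum w ?S) * (real p ^ Suc k * (B * sum \<omega> ?L))"
  proof (rule mult_mono[OF w2])
    have "(\<Sum>q\<in>?S. (F q)\<^sup>2) \<le> real p ^ Suc k * (\<Sum>l\<in>?L. (\<omega> l)\<^sup>2)"
      unfolding F_def by (rule oscillation_sum_norm_le[OF p]) (use \<omega> in blast)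
    also have "\<dots> \<le> real p ^ Suc k * (B * sum \<omega> ?L)" by (rule mult_left_mono[OF \<omega>2]) simp
    finally show "(\<Sum>q\<in>?S. (F q)\<^sup>2) \<le> real p ^ Suc k * (B * sum \<omega> ?L)" .
    show "0 \<le> A * sum w ?S" using w AB by (intro mult_nonneg_nonneg sum_nonneg) auto
  qed (simp add: sum_nonneg)
  also have "\<dots> = real p ^ Suc k * (A * B) * (sum w ?S * sum \<omega> ?L)" by (simp add: mult_ac)
  finally have "(\<Sum>q\<in>?S. w q * F q) \<le> sqrt (real p ^ Suc k * (A * B) * (sum w ?S * sum \<omega> ?L))"
    by (rule real_le_rsqrt)
  thus ?thesis unfolding split by simp
qed

lemma incidences_le_total:
  assumes w: "\<And>q. q \<in> plane p k \<Longrightarrow> 0 \<le> w q" and \<omega>: "\<And>l. l \<in> zlines p k \<Longrightarrow> 0 \<le> \<omega> l"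
  shows "incidences p k w \<omega> \<le> sum w (plane p k) * sum \<omega> (zlines p k)"
  unfolding incidences_def sum_distrib_right
  by (intro sum_mono mult_left_mono) (use w \<omega> in \<open>auto simp: of_bool_def\<close>)

section \<open>Closing the recursion over scales\<close>

text \<open>
  Here \<open>X\<close> stands for the product of the total weights, hence for the trivial bound on the number
  of incidences, and is split as \<open>X\<^sup>c X\<^sup>1\<^sup>-\<^sup>c\<close>.
\<close>

lemma trivial_bound_suffices:
  fixes \<rho> c \<epsilon> C X Y :: real
  assumes \<rho>: "1 < \<rho>" and c: "0 < c" and \<epsilon>: "0 < \<epsilon>" and C: "1 \<le> C"
    and X: "0 \<le> X" and Y: "0 < Y" and XY: "X \<le> \<rho> ^ n * Y"
  shows "X \<le> C * \<rho> powr (real n * (c + \<epsilon>)) * Y powr c * X powr (1 - c)"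
proof -
  have "X = X powr c * X powr (1 - c)" using X by (simp flip: powr_add)
  also have "\<dots> \<le> (\<rho> ^ n * Y) powr c * X powr (1 - c)"
    using X XY c by (intro mult_right_mono powr_mono2) auto
  also have "(\<rho> ^ n * Y) powr c = \<rho> powr (real n * c) * Y powr c"
    using \<rho> Y by (simp add: powr_mult powr_powr flip: powr_realpow)
  also have "\<rho> powr (real n * c) * Y powr c * X powr (1 - c)
      \<le> C * \<rho> powr (real n * (c + \<epsilon>)) * Y powr c * X powr (1 - c)"
  proof (intro mult_right_mono)
    have "1 * \<rho> powr (real n * c) \<le> C * \<rho> powr (real n * (c + \<epsilon>))"
      using \<rho> c \<epsilon> C by (intro mult_mono powr_mono mult_left_mono) auto
    thus "\<rho> powr (real n * c) \<le> C * \<rho> powr (real n * (c + \<epsilon>))" by simp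
  qed auto
  finally show ?thesis .
qed

text \<open>
  \<open>I\<close> and \<open>J\<close> are the incidence counts at levels \<open>k + 1\<close> and \<open>k\<close>, \<open>Y = K\<^sub>\<alpha> K\<^sub>\<beta>\<close> and
  \<open>\<gamma> = \<alpha> + \<beta>\<close>; one coarsening multiplies \<open>Y\<close> by \<open>\<rho>\<close> to the power \<open>\<gamma>\<close>. With
  \<open>B = (\<rho>\<^sup>k\<^sup>+\<^sup>1 Y)\<^sup>c X\<^sup>1\<^sup>-\<^sup>c\<close>, the target is \<open>C \<rho>\<^sup>(\<^sup>k\<^sup>+\<^sup>1\<^sup>)\<^sup>\<epsilon> B\<close>, the square root is at most \<open>B\<close>
  and the low term is at most \<open>C \<rho>\<^sup>k\<^sup>\<epsilon> B\<close>.
\<close>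

lemma scale_recursion_closes:
  fixes \<rho> c \<epsilon> C X Y I J \<gamma> :: real
  assumes \<rho>: "1 < \<rho>" and c: "0 < c" "c \<le> 1 / 2" and c\<gamma>: "c * (\<gamma> - 1) \<le> 1"
    and \<epsilon>: "0 < \<epsilon>" and C: "1 \<le> C" "inverse (\<rho> powr \<epsilon> - 1) \<le> C"
    and X: "0 \<le> X" and Y: "0 < Y" and triv: "I \<le> X"
    and rec: "I \<le> sqrt (\<rho> ^ Suc k * Y * X) + J / \<rho>"
    and J: "J \<le> C * \<rho> powr (real k * (c + \<epsilon>)) * (Y * \<rho> powr \<gamma>) powr c * X powr (1 - c)"
  shows "I \<le> C * \<rho> powr (real (Suc k) * (c + \<epsilon>)) * Y powr c * X powr (1 - c)"
proof (cases "X \<le> \<rho> ^ Suc k * Y")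
  case True
  show ?thesis
    using triv trivial_bound_suffices[OF \<rho> c(1) \<epsilon> C(1) X Y True] by linarith
next
  case False
  define Z where "Z = \<rho> ^ Suc k * Y"
  define B where "B = \<rho> powr (real (Suc k) * c) * Y powr c * X powr (1 - c)"
  have Z: "0 < Z" using \<rho> Y by (simp add: Z_def)
  have ZX: "Z \<le> X" using False by (simp add: Z_def)
  have B0: "0 \<le> B" by (simp add: B_def)
  have Zc: "Z powr c = \<rho> powr (real (Suc k) * c) * Y powr c"
    unfolding Z_def using \<rho> Y by (simp only: powr_mult powr_powr flip: powr_realpow) 
  have "sqrt (Z * X) = Z powr (1 / 2) * X powr (1 / 2)"
    using Z X by (simp add: real_sqrt_mult powr_half_sqrt)
  also have "Z powr (1 / 2) = Z powr c * Z powr (1 / 2 - c)" by (simp flip: powr_add)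
  also have "\<dots> \<le> Z powr c * X powr (1 / 2 - c)"
    using Z ZX c by (intro mult_left_mono powr_mono2) auto
  also have "Z powr c * X powr (1 / 2 - c) * X powr (1 / 2) = B"
    unfolding B_def Zc[symmetric] mult.assoc powr_add[symmetric] by simp
  finally have high: "sqrt (\<rho> ^ Suc k * Y * X) \<le> B"
    by (simp add: Z_def mult_right_mono)
  have "J / \<rho> \<le> C * \<rho> powr (real k * (c + \<epsilon>)) * (Y * \<rho> powr \<gamma>) powr c * X powr (1 - c) / \<rho>"
    using J \<rho> by (intro divide_right_mono) auto
  also have "\<dots> = C * (\<rho> powr (real k * (c + \<epsilon>)) * \<rho> powr (\<gamma> * c) * \<rho> powr (- 1)) * Y powr c * X powr (1 - c)"
    using \<rho> Y by (simp add: powr_mult powr_powr powr_minus divide_inverse mult_ac)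
  also have "\<rho> powr (real k * (c + \<epsilon>)) * \<rho> powr (\<gamma> * c) * \<rho> powr (- 1)
      = \<rho> powr (real k * (c + \<epsilon>) + \<gamma> * c - 1)"
    by (simp only: diff_conv_add_uminus powr_add)
  also have "C * \<dots> * Y powr c * X powr (1 - c)
      \<le> C * \<rho> powr (real (Suc k) * c + real k * \<epsilon>) * Y powr c * X powr (1 - c)"
    using \<rho> C c\<gamma> by (intro mult_right_mono mult_left_mono powr_mono) (auto simp: algebra_simps)
  also have "\<dots> = C * \<rho> powr (real k * \<epsilon>) * B"
    by (simp add: B_def powr_add mult_ac)
  finally have low: "J / \<rho> \<le> C * \<rho> powr (real k * \<epsilon>) * B" .
  \<comment> \<open>The difference between the target and the low term, divided by \<open>B\<close>, absorbs the high term.\<close>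
  have gap: "1 \<le> C * \<rho> powr (real k * \<epsilon>) * (\<rho> powr \<epsilon> - 1)"
  proof -
    have pos: "\<rho> powr \<epsilon> - 1 > 0" using \<rho> \<epsilon> by simp
    have "1 \<le> \<rho> powr (real k * \<epsilon>)" using \<rho> \<epsilon> by (simp add: ge_one_powr_ge_zero)
    moreover have "1 \<le> C * (\<rho> powr \<epsilon> - 1)"
      using C(2) pos by (simp add: field_simps)
    ultimately have "1 * 1 \<le> \<rho> powr (real k * \<epsilon>) * (C * (\<rho> powr \<epsilon> - 1))"
      by (intro mult_mono) auto
    thus ?thesis by (simp add: mult_ac)
  qed
  have "I \<le> B + C * \<rho> powr (real k * \<epsilon>) * B" using rec high low by linarith
  also have "\<dots> = (1 + C * \<rho> powr (real k * \<epsilon>)) * B" by (simp add: algebra_simps)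
  also have "\<dots> \<le> (C * \<rho> powr (real k * \<epsilon>) * \<rho> powr \<epsilon>) * B"
    using gap by (intro mult_right_mono B0) (simp add: algebra_simps)
  also have "\<dots> = C * \<rho> powr (real (Suc k) * (c + \<epsilon>)) * Y powr c * X powr (1 - c)"
    by (simp add: B_def mult_ac flip: powr_add) (simp add: algebra_simps)
  finally show ?thesis .
qed

section \<open>Non-concentration at all scales\<close>

text \<open>
  The real-valued counterpart of \<^const>\<open>point_set\<close>, for weights on the whole plane. Coarsening then
  only changes the weight function, not the underlying set.
\<close>

definition spread_points :: "nat \<Rightarrow> nat \<Rightarrow> real \<Rightarrow> real \<Rightarrow> (int \<times> int \<Rightarrow> real) \<Rightarrow> bool" where
  "spread_points p k \<alpha> K w \<longleftrightarrow> (\<forall>q\<in>plane p k. 0 \<le> w q) \<and>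
    (\<forall>j\<le>k. \<forall>Q\<in>cubes p k j. sum w Q \<le> K * real p powr (\<alpha> * real (k - j)))"

definition tube :: "nat \<Rightarrow> nat \<Rightarrow> nat \<Rightarrow> (int \<times> int) set \<Rightarrow> (int \<times> int) set" where
  "tube p k j m = {y \<in> plane p k. reduction p j y \<in> m}"

definition spread_lines ::
  "nat \<Rightarrow> nat \<Rightarrow> real \<Rightarrow> real \<Rightarrow> ((int \<times> int) set \<Rightarrow> real) \<Rightarrow> bool" where
  "spread_lines p k \<beta> K \<omega> \<longleftrightarrow> (\<forall>l\<in>zlines p k. 0 \<le> \<omega> l) \<and>
    (\<forall>j\<le>k. \<forall>m\<in>zlines p j.
      sum \<omega> {l \<in> zlines p k. l \<subseteq> tube p k j m} \<le> K * real p powr (\<beta> * real (k - j)))"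

lemma zlines_subset_plane: "l \<in> zlines p k \<Longrightarrow> l \<subseteq> plane p k"
  by (auto simp: zlines_def zline_def)

lemma reduction_plane_id: "x \<in> plane p k \<Longrightarrow> reduction p k x = x"
  by (auto simp: plane_eq reduction_def)

lemma reduction_reduction: "j \<le> k \<Longrightarrow> reduction p j (reduction p k x) = reduction p j x"
  by (simp add: reduction_def mod_mod_cancel le_imp_power_dvd)

lemma spread_points_le:
  assumes p: "prime p" and w: "spread_points p k \<alpha> K w" and q: "q \<in> plane p k"
  shows "w q \<le> K"
proof -
  have single: "{y \<in> plane p k. int p ^ k dvd fst y - fst q \<and> int p ^ k dvd snd y - snd q} = {q}"
  proof -
    have "y = q" if "y \<in> plane p k" "int p ^ k dvd fst y - fst q" "int p ^ k dvd snd y - snd q" for y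
    proof -
      have "reduction p k y = reduction p k q"
        using that by (simp add: reduction_def mod_eq_dvd_iff)
      thus ?thesis using that(1) q by (simp add: reduction_plane_id)
    qed
    thus ?thesis using q by auto
  qed
  have "{q} \<in> cubes p k k" unfolding cubes_def single[symmetric] using q by blast
  thus ?thesis using w prime_gt_0_nat[OF p] by (fastforce simp: spread_points_def)
qed

lemma spread_lines_le:
  assumes p: "prime p" and \<omega>: "spread_lines p k \<beta> K \<omega>" and m: "m \<in> zlines p k"
  shows "\<omega> m \<le> K"
proof -
  have "m \<subseteq> tube p k k m"
    using zlines_subset_plane[OF m] by (auto simp: tube_def reduction_plane_id subset_iff)
  hence "\<omega> m \<le> sum \<omega> {l \<in> zlines p k. l \<subseteq> tube p k k m}"
    using m \<omega> by (intro member_le_sum) (auto simp: spread_lines_def)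
  also have "\<dots> \<le> K * real p powr (\<beta> * real (k - k))" using \<omega> m unfolding spread_lines_def by blast
  finally show ?thesis using prime_gt_0_nat[OF p] by simp
qed

text \<open>
  Coarsening keeps the resolution \<open>p\<^sup>-\<^sup>j\<close> of cubes and tubes but shortens the distance to the
  finest scale by one; the lost factor \<open>\<rho>\<close> to the power \<open>\<gamma>\<close> is absorbed in the constant.
\<close>

lemma powr_scale_shift:
  assumes "j \<le> k"
  shows "(K::real) * \<rho> powr (\<gamma> * real (Suc k - j)) = K * \<rho> powr \<gamma> * \<rho> powr (\<gamma> * real (k - j))"
proof -
  have "\<gamma> * real (Suc k - j) = \<gamma> + \<gamma> * real (k - j)"
    using assms by (simp add: algebra_simps)
  thus ?thesis by (simp only: powr_add mult.assoc)
qed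

text \<open>
  The preimage of a cube under reduction is a cube of the same resolution one level higher.
\<close>

lemma spread_points_coarsen:
  assumes p: "prime p" and w: "spread_points p (Suc k) \<alpha> K w"
  shows "spread_points p k \<alpha> (K * real p powr \<alpha>) (coarsen_points p k w)"
  unfolding spread_points_def
proof (intro conjI ballI allI impI)
  show "0 \<le> coarsen_points p k w q" for q
    using w by (intro pushforward_nonneg) (simp add: spread_points_def)
next
  fix j Q assume j: "j \<le> k" and "Q \<in> cubes p k j"
  then obtain x where x: "x \<in> plane p k"
    and Q: "Q = {y \<in> plane p k. int p ^ j dvd fst y - fst x \<and> int p ^ j dvd snd y - snd x}"
    by (auto simp: cubes_def)
  have red: "int p ^ j dvd a mod int p ^ k - b \<longleftrightarrow> int p ^ j dvd a - b" for a b
    using j by (simp add: le_imp_power_dvd mod_mod_cancel flip: mod_eq_dvd_iff)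
  have "{y \<in> plane p (Suc k). reduction p k y \<in> Q}
      = {y \<in> plane p (Suc k). int p ^ j dvd fst y - fst x \<and> int p ^ j dvd snd y - snd x}"
    unfolding Q using reduction_in_plane[OF p] by (auto simp: reduction_def red)
  moreover have "x \<in> plane p (Suc k)"
  proof -
    have "int p ^ k \<le> int p ^ Suc k" using prime_gt_0_nat[OF p] by simp
    thus ?thesis using x unfolding plane_eq by fastforce
  qed
  ultimately have cube: "{y \<in> plane p (Suc k). reduction p k y \<in> Q} \<in> cubes p (Suc k) j"
    unfolding cubes_def by blast
  have "sum (coarsen_points p k w) Q = sum w {y \<in> plane p (Suc k). reduction p k y \<in> Q}"
    by (rule sum_pushforward_subset[where T = "plane p k"]) (use reduction_plane[OF p] Q in auto)
  also have "\<dots> \<le> K * real p powr (\<alpha> * real (Suc k - j))"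
    using w cube j unfolding spread_points_def by simp
  finally show "sum (coarsen_points p k w) Q \<le> K * real p powr \<alpha> * real p powr (\<alpha> * real (k - j))"
    by (simp only: powr_scale_shift[OF j])
qed

text \<open>
  A line reduces into a tube exactly when it lies in the preimage of the tube, which is the tube
  of the same resolution one level higher.
\<close>

lemma spread_lines_coarsen:
  assumes p: "prime p" and \<omega>: "spread_lines p (Suc k) \<beta> K \<omega>"
  shows "spread_lines p k \<beta> (K * real p powr \<beta>) (coarsen_lines p k \<omega>)"
  unfolding spread_lines_def
proof (intro conjI ballI allI impI)
  show "0 \<le> coarsen_lines p k \<omega> l" for l
    using \<omega> by (intro pushforward_nonneg) (simp add: spread_lines_def)
next
  fix j m assume j: "j \<le> k" and m: "m \<in> zlines p j"
  have iff: "reduction p k ` l \<subseteq> tube p k j m \<longleftrightarrow> l \<subseteq> tube p (Suc k) j m" if "l \<in> zlines p (Suc k)" for l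
    using zlines_subset_plane[OF that] reduction_in_plane[OF p]
    by (auto simp: tube_def reduction_reduction[OF j] image_subset_iff)
  have "sum (coarsen_lines p k \<omega>) {l \<in> zlines p k. l \<subseteq> tube p k j m}
      = sum \<omega> {l \<in> zlines p (Suc k). reduction p k ` l \<in> {l \<in> zlines p k. l \<subseteq> tube p k j m}}"
    by (rule sum_pushforward_subset[where T = "zlines p k"]) (use reduction_zlines[OF p] in auto)
  also have "{l \<in> zlines p (Suc k). reduction p k ` l \<in> {l \<in> zlines p k. l \<subseteq> tube p k j m}}
      = {l \<in> zlines p (Suc k). l \<subseteq> tube p (Suc k) j m}"
    using iff reduction_zlines[OF p] by blast
  also have "sum \<omega> \<dots> \<le> K * real p powr (\<beta> * real (Suc k - j))"
    using \<omega> m j unfolding spread_lines_def by simp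
  finally show "sum (coarsen_lines p k \<omega>) {l \<in> zlines p k. l \<subseteq> tube p k j m}
      \<le> K * real p powr \<beta> * real p powr (\<beta> * real (k - j))"
    by (simp only: powr_scale_shift[OF j])
qed

section \<open>Induction on the scale\<close>

lemma zlines_0: "prime p \<Longrightarrow> zlines p 0 = {{(0, 0)}}"
  by (auto simp: zlines_def zline_def primitive_def intro!: exI[of _ 1])

lemma sum_coarsen_points:
  assumes "prime p" shows "sum (coarsen_points p k w) (plane p k) = sum w (plane p (Suc k))"
  using sum_pushforward[OF finite_plane finite_plane reduction_plane[OF assms], where \<phi> = "\<lambda>_. 1"] by simp

lemma sum_coarsen_lines:
  assumes "prime p" shows "sum (coarsen_lines p k \<omega>) (zlines p k) = sum \<omega> (zlines p (Suc k))"
  using sum_pushforward[OF finite_zlines finite_zlines reduction_zlines[OF assms], where \<phi> = "\<lambda>_. 1"] by simp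

text \<open>
  At level \<open>0\<close> there is one point and one line, so the total weights are at most \<open>K\<^sub>\<alpha>\<close> and \<open>K\<^sub>\<beta>\<close>
  and the trivial bound suffices. The constants \<open>K\<^sub>\<alpha>\<close>, \<open>K\<^sub>\<beta>\<close> have to vary in the induction because
  coarsening enlarges them.
\<close>

lemma incidences_bound:
  assumes p: "prime p" and c: "0 < c" "c \<le> 1 / 2" "c * (\<alpha> + \<beta> - 1) \<le> 1"
    and \<epsilon>: "0 < \<epsilon>" and C: "1 \<le> C" "inverse (real p powr \<epsilon> - 1) \<le> C"
    and K: "0 < K\<^sub>\<alpha>" "0 < K\<^sub>\<beta>"
    and w: "spread_points p k \<alpha> K\<^sub>\<alpha> w" and \<omega>: "spread_lines p k \<beta> K\<^sub>\<beta> \<omega>"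
  shows "incidences p k w \<omega> \<le> C * real p powr (real k * (c + \<epsilon>)) * (K\<^sub>\<alpha> * K\<^sub>\<beta>) powr c
           * (sum w (plane p k) * sum \<omega> (zlines p k)) powr (1 - c)"
  using K w \<omega>
proof (induction k arbitrary: K\<^sub>\<alpha> K\<^sub>\<beta> w \<omega>)
  case (0 K\<^sub>\<alpha> K\<^sub>\<beta> w \<omega>)
  have p1: "1 < real p" using prime_gt_1_nat[OF p] by simp
  let ?X = "sum w (plane p 0) * sum \<omega> (zlines p 0)"
  have L: "{(0, 0)} \<in> zlines p 0" using zlines_0[OF p] by simp
  have w: "0 \<le> w (0, 0)" "w (0, 0) \<le> K\<^sub>\<alpha>"
    using 0 spread_points_le[OF p 0(3)] by (auto simp: spread_points_def)
  have \<omega>: "0 \<le> \<omega> {(0, 0)}" "\<omega> {(0, 0)} \<le> K\<^sub>\<beta>"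
    using 0 L spread_lines_le[OF p 0(4)] by (auto simp: spread_lines_def)
  have "incidences p 0 w \<omega> \<le> ?X"
    using 0 by (intro incidences_le_total) (auto simp: spread_points_def spread_lines_def)
  also have "\<dots> \<le> C * real p powr (real 0 * (c + \<epsilon>)) * (K\<^sub>\<alpha> * K\<^sub>\<beta>) powr c * ?X powr (1 - c)"
    using w \<omega> 0(1,2) by (intro trivial_bound_suffices[OF p1 c(1) \<epsilon> C(1)]) (auto simp: zlines_0[OF p] intro!: mult_mono)
  finally show ?case .
next
  case (Suc k K\<^sub>\<alpha> K\<^sub>\<beta> w \<omega>)
  have p1: "1 < real p" using prime_gt_1_nat[OF p] by simp
  let ?X = "sum w (plane p (Suc k)) * sum \<omega> (zlines p (Suc k))"
  let ?J = "incidences p k (coarsen_points p k w) (coarsen_lines p k \<omega>)"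
  have w: "0 \<le> w q \<and> w q \<le> K\<^sub>\<alpha>" if "q \<in> plane p (Suc k)" for q
    using that Suc.prems(3) spread_points_le[OF p Suc.prems(3)] by (auto simp: spread_points_def)
  have \<omega>: "0 \<le> \<omega> l \<and> \<omega> l \<le> K\<^sub>\<beta>" if "l \<in> zlines p (Suc k)" for l
    using that Suc.prems(4) spread_lines_le[OF p Suc.prems(4)] by (auto simp: spread_lines_def)
  show ?case
  proof (rule scale_recursion_closes[OF p1 c \<epsilon> C])
    show "0 \<le> ?X" using w \<omega> by (simp add: sum_nonneg)
    show "0 < K\<^sub>\<alpha> * K\<^sub>\<beta>" using Suc.prems by simp
    show "incidences p (Suc k) w \<omega> \<le> ?X" using w \<omega> by (intro incidences_le_total) auto
    show "incidences p (Suc k) w \<omega> \<le> sqrt (real p ^ Suc k * (K\<^sub>\<alpha> * K\<^sub>\<beta>) * ?X) + ?J / real p"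
      using w \<omega> Suc.prems by (intro incidences_step[OF p]) auto
    have "?J \<le> C * real p powr (real k * (c + \<epsilon>)) * ((K\<^sub>\<alpha> * real p powr \<alpha>) * (K\<^sub>\<beta> * real p powr \<beta>)) powr c
        * ?X powr (1 - c)"
      using Suc.IH[OF _ _ spread_points_coarsen[OF p Suc.prems(3)] spread_lines_coarsen[OF p Suc.prems(4)]]
        Suc.prems p1 by (simp only: sum_coarsen_points[OF p] sum_coarsen_lines[OF p]) simp
    thus "?J \<le> C * real p powr (real k * (c + \<epsilon>)) * (K\<^sub>\<alpha> * K\<^sub>\<beta> * real p powr (\<alpha> + \<beta>)) powr c
        * ?X powr (1 - c)"
      by (simp add: powr_add mult_ac)
  qed
qed

section \<open>Passing from subsets with integer weights to real weights\<close>

lemma tubes_eq: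
  assumes p: "prime p" shows "tubes p k j = tube p k j ` zlines p j"
proof (cases "j = 0")
  case True
  have "tube p k 0 {(0, 0)} = plane p k" by (auto simp: tube_def reduction_def)
  thus ?thesis using True by (simp add: tubes_def zlines_0[OF p])
next
  case False
  thus ?thesis using lines_eq_zlines[OF p, of j] by (auto simp: tubes_def tube_def)
qed

lemma sum_extend_by_zero:
  assumes "finite T" "P \<subseteq> T" "A \<subseteq> T"
  shows "(\<Sum>q\<in>A. (if q \<in> P then real (w q) else 0)) = real (\<Sum>q\<in>{q \<in> P. q \<in> A}. w q)"
proof -
  have "{q \<in> P. q \<in> A} = A \<inter> P" by auto
  thus ?thesis using finite_subset[OF assms(3,1)] by (simp add: sum.If_cases Int_def)
qed

lemma point_set_spread:
  assumes "point_set p k \<alpha> K P w"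
  shows "spread_points p k \<alpha> K (\<lambda>q. if q \<in> P then real (w q) else 0)"
proof -
  have P: "P \<subseteq> plane p k" using assms by (simp add: point_set_def)
  show ?thesis unfolding spread_points_def
  proof (intro conjI ballI allI impI)
    fix j Q assume jQ: "j \<le> k" "Q \<in> cubes p k j"
    hence "Q \<subseteq> plane p k" by (auto simp: cubes_def)
    thus "(\<Sum>q\<in>Q. if q \<in> P then real (w q) else 0) \<le> K * real p powr (\<alpha> * real (k - j))"
      using assms jQ unfolding point_set_def sum_extend_by_zero[OF finite_plane P \<open>Q \<subseteq> plane p k\<close>] by blast
  qed simp
qed

lemma line_set_spread:
  assumes p: "prime p" and k: "k \<ge> 1" and L: "line_set p k \<beta> K L \<omega>"
  shows "spread_lines p k \<beta> K (\<lambda>l. if l \<in> L then real (\<omega> l) else 0)"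
proof -
  have sub: "L \<subseteq> zlines p k" using L lines_eq_zlines[OF p k] by (simp add: line_set_def)
  show ?thesis unfolding spread_lines_def
  proof (intro conjI ballI allI impI)
    fix j m assume j: "j \<le> k" and m: "m \<in> zlines p j"
    let ?A = "{l \<in> zlines p k. l \<subseteq> tube p k j m}"
    have "(\<Sum>l\<in>?A. if l \<in> L then real (\<omega> l) else 0) = real (\<Sum>l\<in>{l \<in> L. l \<in> ?A}. \<omega> l)"
      by (rule sum_extend_by_zero[OF finite_zlines sub]) auto
    also have "{l \<in> L. l \<in> ?A} = {l \<in> L. l \<subseteq> tube p k j m}" using sub by auto
    also have "real (\<Sum>l\<in>\<dots>. \<omega> l) \<le> K * real p powr (\<beta> * real (k - j))"
      using L j m tubes_eq[OF p] unfolding line_set_def by blast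
    finally show "(\<Sum>l\<in>?A. if l \<in> L then real (\<omega> l) else 0) \<le> K * real p powr (\<beta> * real (k - j))" .
  qed simp
qed

lemma incidences_extend_by_zero:
  assumes P: "P \<subseteq> plane p k" and L: "L \<subseteq> zlines p k"
  shows "incidences p k (\<lambda>q. if q \<in> P then real (w q) else 0) (\<lambda>l. if l \<in> L then real (\<omega> l) else 0)
    = real (weighted_incidences w \<omega> P L)"
proof -
  have ext: "(\<Sum>x\<in>T. (if x \<in> A then real (f x) else 0) * g x) = (\<Sum>x\<in>A. real (f x) * g x)"
    if "finite T" "A \<subseteq> T" for T A :: "'x set" and f and g :: "'x \<Rightarrow> real"
    using that by (intro sum.mono_neutral_cong_right) auto
  show ?thesis
    unfolding incidences_def ext[OF finite_plane P] ext[OF finite_zlines L] weighted_incidences_def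
    by (simp add: sum_distrib_left mult.assoc)
qed

lemma weighted_incidences_bound:
  assumes p: "prime p" and k: "k \<ge> 1" and c: "0 < c" "c \<le> 1 / 2" "c * (\<alpha> + \<beta> - 1) \<le> 1"
    and \<epsilon>: "0 < \<epsilon>" and C: "1 \<le> C" "inverse (real p powr \<epsilon> - 1) \<le> C"
    and K: "0 < K\<^sub>\<alpha>" "0 < K\<^sub>\<beta>"
    and P: "point_set p k \<alpha> K\<^sub>\<alpha> P w" and L: "line_set p k \<beta> K\<^sub>\<beta> L \<omega>"
  shows "real (weighted_incidences w \<omega> P L)
          \<le> C * real p powr (real k * (c + \<epsilon>)) * (K\<^sub>\<alpha> * K\<^sub>\<beta>) powr c
              * real (\<Sum>q\<in>P. w q) powr (1 - c) * real (\<Sum>l\<in>L. \<omega> l) powr (1 - c)"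
proof -
  have Ps: "P \<subseteq> plane p k" using P by (simp add: point_set_def)
  have Ls: "L \<subseteq> zlines p k" using L lines_eq_zlines[OF p k] by (simp add: line_set_def)
  have "{q \<in> P. q \<in> plane p k} = P" "{l \<in> L. l \<in> zlines p k} = L" using Ps Ls by auto
  hence tot: "(\<Sum>q\<in>plane p k. if q \<in> P then real (w q) else 0) = real (\<Sum>q\<in>P. w q)"
    "(\<Sum>l\<in>zlines p k. if l \<in> L then real (\<omega> l) else 0) = real (\<Sum>l\<in>L. \<omega> l)"
    using sum_extend_by_zero[OF finite_plane Ps subset_refl] sum_extend_by_zero[OF finite_zlines Ls subset_refl]
    by metis+
  show ?thesis
    using incidences_bound[OF p c \<epsilon> C K point_set_spread[OF P] line_set_spread[OF p k L]]
    unfolding tot incidences_extend_by_zero[OF Ps Ls]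
    by (simp add: powr_mult mult.assoc del: of_nat_sum)
qed

lemma card_incidences:
  assumes "finite P" "finite L"
  shows "card {(q, l). q \<in> P \<and> l \<in> L \<and> q \<in> l} = weighted_incidences (\<lambda>_. 1) (\<lambda>_. 1) P L"
proof -
  have "{(q, l). q \<in> P \<and> l \<in> L \<and> q \<in> l} = (SIGMA q:P. {l \<in> L. q \<in> l})" by auto
  thus ?thesis using assms by (simp add: weighted_incidences_def Int_def)
qed

theorem theorem1p3:
  fixes p :: nat and \<epsilon> \<alpha> \<beta> c C :: real
  assumes "prime p"
    and "0 < \<epsilon>" "\<epsilon> < 1"
    and "0 \<le> \<alpha>" "\<alpha> \<le> 2" "0 \<le> \<beta>" "\<beta> \<le> 2"
    and "inverse c = max (\<alpha> + \<beta> - 1) 2"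
    and "C > max (real p powr (1 - \<epsilon>)) (inverse (real p powr \<epsilon> - 1))"
  shows "C > 0 \<and>
    (\<forall>(k::nat) (K\<^sub>\<alpha>::real) (K\<^sub>\<beta>::real). k \<ge> 1 \<and> K\<^sub>\<alpha> > 0 \<and> K\<^sub>\<beta> > 0 \<longrightarrow>
      (\<forall>P w L \<omega>. point_set p k \<alpha> K\<^sub>\<alpha> P w \<and> line_set p k \<beta> K\<^sub>\<beta> L \<omega> \<longrightarrow>
        real (weighted_incidences w \<omega> P L)
          \<le> C * real p powr (real k * (c + \<epsilon>)) * (K\<^sub>\<alpha> * K\<^sub>\<beta>) powr c
              * real (\<Sum>q\<in>P. w q) powr (1 - c) * real (\<Sum>l\<in>L. \<omega> l) powr (1 - c)) \<and>
      (\<forall>P L. point_set p k \<alpha> K\<^sub>\<alpha> P (\<lambda>_. 1) \<and> line_set p k \<beta> K\<^sub>\<beta> L (\<lambda>_. 1) \<longrightarrow>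
        real (card {(q, l). q \<in> P \<and> l \<in> L \<and> q \<in> l})
          \<le> C * real p powr (real k * (c + \<epsilon>)) * (K\<^sub>\<alpha> * K\<^sub>\<beta>) powr c
              * real (card P) powr (1 - c) * real (card L) powr (1 - c)))"
proof (intro conjI allI impI; (elim conjE)?)
  have p1: "1 < real p" using prime_gt_1_nat[OF assms(1)] by simp
  have "1 \<le> real p powr (1 - \<epsilon>)" using p1 assms(3) by (simp add: ge_one_powr_ge_zero)
  hence C: "1 \<le> C" "inverse (real p powr \<epsilon> - 1) \<le> C" using assms(9) by auto
  show "C > 0" using C by simp
  have inv: "2 \<le> inverse c" "\<alpha> + \<beta> - 1 \<le> inverse c" using assms(8) by auto
  have c0: "0 < c" using inv(1) by (metis inverse_positive_iff_positive zero_less_numeral less_le_trans)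
  have c: "c \<le> 1 / 2" "c * (\<alpha> + \<beta> - 1) \<le> 1"
    using inv c0 by (simp_all add: field_simps)
  fix k :: nat and K\<^sub>\<alpha> K\<^sub>\<beta> :: real
  assume k: "k \<ge> 1" and K: "0 < K\<^sub>\<alpha>" "0 < K\<^sub>\<beta>"
  note bound = weighted_incidences_bound[OF assms(1) k c0 c assms(2) C K]
  show "real (weighted_incidences w \<omega> P L)
          \<le> C * real p powr (real k * (c + \<epsilon>)) * (K\<^sub>\<alpha> * K\<^sub>\<beta>) powr c
              * real (\<Sum>q\<in>P. w q) powr (1 - c) * real (\<Sum>l\<in>L. \<omega> l) powr (1 - c)"
    if "point_set p k \<alpha> K\<^sub>\<alpha> P w" "line_set p k \<beta> K\<^sub>\<beta> L \<omega>" for P w L \<omega>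
    using that by (rule bound)
  show "real (card {(q, l). q \<in> P \<and> l \<in> L \<and> q \<in> l})
          \<le> C * real p powr (real k * (c + \<epsilon>)) * (K\<^sub>\<alpha> * K\<^sub>\<beta>) powr c
              * real (card P) powr (1 - c) * real (card L) powr (1 - c)"
    if P: "point_set p k \<alpha> K\<^sub>\<alpha> P (\<lambda>_. 1)" and L: "line_set p k \<beta> K\<^sub>\<beta> L (\<lambda>_. 1)" for P L
  proof -
    have "finite P" "finite L"
      using P L lines_eq_zlines[OF assms(1) k] finite_subset[OF _ finite_plane] finite_subset[OF _ finite_zlines]
      by (auto simp: point_set_def line_set_def)
    thus ?thesis using bound[OF P L] card_incidences[of P L] by simp
  qed
qed

end
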